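(* There exist universal constants $C_0, C_1 > 0$ such that the following holds. Let $X \subset \mathbb{R}^m$ be a finite nonempty set with doubling dimension $d_X$, let $\epsilon \in (0,1/2)$, let $d \ge 1$ be an integer with $d \ge C_0 \cdot d_X \cdot \log(1/\epsilon)/\epsilon^2$, and let $G$ be a random projection from $\mathbb{R}^m$ to $\mathbb{R}^d$. Let $\mathcal{F}_d \subseteq X$ be a (random, depending measurably on $G$) set of facilities such that $G\mathcal{F}_d$ is a locally optimal solution for the dataset $GX$. Let $\mathrm{cost}_m(\mathcal{F}_d)$ be the facility location cost of $\mathcal{F}_d$ for $X$ in $\mathbb{R}^m$, let $\mathrm{cost}_d(\mathcal{F}_d)$ be the facility location cost of $G\mathcal{F}_d$ for $GX$ in $\mathbb{R}^d$, let $r_p$ be the radius of $p$ in $X$, and let $F$ be the optimal facility location cost of $X$ in $\mathbb{R}^m$. Then $$ \mathbb{E}[\mathrm{cost}_m(\mathcal{F}_d)] \le \mathbb{E}|\mathcal{F}_d| + C_1 \sum_{p \in X} r_p \qquad\text{and}\qquad \mathbb{E}|\mathcal{F}_d| + C_1 \sum_{p \in X} r_p \le \mathbb{E}[\mathrm{cost}_d(\mathcal{F}_d)] + 6\,C_1 F,$$ i.e. $\mathbb{E}[\mathrm{cost}_m(\mathcal{F}_d)] \le \mathbb{E}|\mathcal{F}_d| + O(\sum_{p\in X} r_p) \le \mathbb{E}[\mathrm{cost}_d(\mathcal{F}_d)] + O(F)$, where expectations are over $G$.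
   Context: All norms are Euclidean. Facility location (uniform, opening cost 1): for a finite nonempty dataset $Y$ in a Euclidean space, a solution is a nonempty subset $\mathcal{F} \subseteq Y$, with cost $|\mathcal{F}| + \sum_{y \in Y} \min_{f \in \mathcal{F}} \|y - f\|$. Radii: for a finite dataset $Y$ and $p \in Y$, the radius $r_p > 0$ of $p$ in $Y$ is the unique number with $\sum_{q \in Y,\ \|p-q\| \le r_p} (r_p - \|p-q\|) = 1$ (the sum includes $q = p$). A solution $\mathcal{F} \subseteq Y$ is locally optimal for $Y$ if for every $p \in Y$ there is $f \in \mathcal{F}$ with $\|p-f\| \le 3 r_p$. For the dataset $GX$ the radii are computed in $\mathbb{R}^d$ from the points $Gx$, $x \in X$. Doubling dimension: for $x \in X$, $r > 0$ let $B(x,r) = \{y \in X : \|x-y\| \le r\}$. The doubling constant $\lambda_X$ is the smallest $\lambda$ such that for all $x \in X$, $r > 0$ there is $S \subseteq X$ with $|S| \le \lambda$ and $B(x,r) \subseteq \bigcup_{s \in S} B(s, r/2)$. The doubling dimension is $d_X = \log_2 \lambda_X$. A random projection from $\mathbb{R}^m$ to $\mathbb{R}^d$ is a random linear map $G$ given by a $d \times m$ matrix with i.i.d. entries drawn from $\mathcal{N}(0, 1/d)$ (variance $1/d$). Almost surely $G$ is injective on $X$. *)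

theory Defs
  imports "HOL-Probability.Probability"
begin

text \<open>
  The constants of the theorem must not depend on the dimensions, so the dimension has to be a
  term and not a type. A point of Euclidean \<open>n\<close>-space is an extensional function on \<open>{..<n}\<close>
  (undefined elsewhere), so that equality of points is equality of coordinates.
  The type class \<open>dist\<close> on \<open>nat \<Rightarrow> real\<close> is not the Euclidean one and is not used.
\<close>

definition Rn :: "nat \<Rightarrow> (nat \<Rightarrow> real) set" where
  "Rn n = ({..<n} \<rightarrow>\<^sub>E UNIV)"

definition edist :: "nat \<Rightarrow> (nat \<Rightarrow> real) \<Rightarrow> (nat \<Rightarrow> real) \<Rightarrow> real" where
  "edist n x y = L2_set (\<lambda>i. x i - y i) {..<n}"

definition fl_solution :: "(nat \<Rightarrow> real) set \<Rightarrow> (nat \<Rightarrow> real) set \<Rightarrow> bool" where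
  "fl_solution Y F \<longleftrightarrow> F \<noteq> {} \<and> F \<subseteq> Y"

definition fl_cost :: "nat \<Rightarrow> (nat \<Rightarrow> real) set \<Rightarrow> (nat \<Rightarrow> real) set \<Rightarrow> real" where
  "fl_cost n Y F = real (card F) + (\<Sum>y\<in>Y. Min ((\<lambda>f. edist n y f) ` F))"

definition fl_opt :: "nat \<Rightarrow> (nat \<Rightarrow> real) set \<Rightarrow> real" where
  "fl_opt n Y = Min (fl_cost n Y ` {F. fl_solution Y F})"

definition radius :: "nat \<Rightarrow> (nat \<Rightarrow> real) set \<Rightarrow> (nat \<Rightarrow> real) \<Rightarrow> real" where
  "radius n Y p = (THE r. r > 0 \<and> (\<Sum>q | q \<in> Y \<and> edist n p q \<le> r. r - edist n p q) = 1)"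

definition locally_optimal :: "nat \<Rightarrow> (nat \<Rightarrow> real) set \<Rightarrow> (nat \<Rightarrow> real) set \<Rightarrow> bool" where
  "locally_optimal n Y F \<longleftrightarrow>
     fl_solution Y F \<and> (\<forall>p\<in>Y. \<exists>f\<in>F. edist n p f \<le> 3 * radius n Y p)"

definition rel_ball :: "nat \<Rightarrow> (nat \<Rightarrow> real) set \<Rightarrow> (nat \<Rightarrow> real) \<Rightarrow> real \<Rightarrow> (nat \<Rightarrow> real) set" where
  "rel_ball n X x r = {y \<in> X. edist n x y \<le> r}"

definition doubling_const :: "nat \<Rightarrow> (nat \<Rightarrow> real) set \<Rightarrow> nat" where
  "doubling_const n X =
     (LEAST l. \<forall>x\<in>X. \<forall>r>0. \<exists>S\<subseteq>X. finite S \<and> card S \<le> l \<and>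
        rel_ball n X x r \<subseteq> (\<Union>s\<in>S. rel_ball n X s (r / 2)))"

definition doubling_dim :: "nat \<Rightarrow> (nat \<Rightarrow> real) set \<Rightarrow> real" where
  "doubling_dim n X = log 2 (real (doubling_const n X))"

text \<open>
  The law of a \<open>d \<times> m\<close> matrix with independent entries of variance \<open>1 / d\<close>.
  The second parameter of \<^const>\<open>normal_density\<close> is the standard deviation.
\<close>

definition gaussian_matrix :: "nat \<Rightarrow> nat \<Rightarrow> (nat \<times> nat \<Rightarrow> real) measure" where
  "gaussian_matrix d m =
     (\<Pi>\<^sub>M ij\<in>{..<d} \<times> {..<m}. density lborel (normal_density 0 (sqrt (1 / real d))))"

definition mat_app :: "nat \<Rightarrow> nat \<Rightarrow> (nat \<times> nat \<Rightarrow> real) \<Rightarrow> (nat \<Rightarrow> real) \<Rightarrow> (nat \<Rightarrow> real)" where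
  "mat_app d m G x = (\<lambda>i\<in>{..<d}. \<Sum>j<m. G (i, j) * x j)"

end

theory Submission
  imports Defs
begin

text \<open>
  Write \<open>s\<close> for the radius of \<open>p\<close>. By local optimality some facility \<open>f\<close> satisfies
  \<open>\<parallel>Gp - Gf\<parallel> \<le> 3 r'\<close>, where \<open>r'\<close> is the radius of \<open>Gp\<close> in \<open>GX\<close>, and \<open>r' \<le> s + M p\<close>, where
  \<open>M y\<close> is the largest \<open>\<parallel>Gx - Gy\<parallel>\<close> over the \<open>x\<close> in the ball of radius \<open>s\<close> about \<open>y\<close>. If \<open>f\<close> lies at
  distance about \<open>16\<^sup>i s\<close> from \<open>p\<close>, take \<open>y\<close> at distance at most \<open>s\<close> from \<open>f\<close> in an \<open>s\<close>-net of
  at most \<open>\<lambda>\<^sup>8\<^sup>i\<close> points, \<open>\<lambda>\<close> being the doubling constant. Then either \<open>\<parallel>Gp - Gy\<parallel> \<le> 4\<^sup>i s\<close>, a contraction of the single vector \<open>p - y\<close> by a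
  factor of order \<open>4\<^sup>i\<close>, or one of \<open>M p\<close>, \<open>M y\<close> exceeds \<open>4\<^sup>i s / 12\<close>. Both have probability
  \<open>O(4\<^sup>-\<^sup>i)\<^sup>d\<close>, which beats the union bound over the net and the factor \<open>16\<^sup>i\<close> as soon as
  \<open>\<lambda>\<^sup>8 \<le> 2\<^sup>d\<close>. Hence the expected distance from \<open>p\<close> to the facilities is \<open>O(s)\<close>. The second
  inequality is the bound \<open>\<Sum> r\<^sub>p \<le> 2 F\<close>, obtained cluster by cluster.

  Every probability estimate is phrased as an integrable majorant with small integral, so that
  neither suprema nor exceptional events need to be shown measurable.
\<close>

section \<open>Euclidean distance and radii\<close>

lemma edist_nonneg [simp]: "0 \<le> edist n x y"
  by (simp add: edist_def)

lemma edist_self [simp]: "edist n x x = 0"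
  by (simp add: edist_def L2_set_def)

lemma edist_commute: "edist n x y = edist n y x"
  by (simp add: edist_def L2_set_def power2_commute)

lemma edist_triangle: "edist n x z \<le> edist n x y + edist n y z"
proof -
  have "L2_set (\<lambda>i. (x i - y i) + (y i - z i)) {..<n}
      \<le> L2_set (\<lambda>i. x i - y i) {..<n} + L2_set (\<lambda>i. y i - z i) {..<n}"
    by (rule L2_set_triangle_ineq)
  then show ?thesis by (simp add: edist_def)
qed

lemma edist_power2: "(edist n x y)\<^sup>2 = (\<Sum>i<n. (x i - y i)\<^sup>2)"
  by (simp add: edist_def L2_set_def sum_nonneg)

lemma edist_eq_0_iff:
  assumes "x \<in> Rn n" "y \<in> Rn n"
  shows "edist n x y = 0 \<longleftrightarrow> x = y"
proof
  assume "edist n x y = 0"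
  then have "\<forall>i<n. x i = y i" by (simp add: edist_def L2_set_eq_0_iff)
  then show "x = y" using assms unfolding Rn_def by (intro PiE_ext[of x "{..<n}" _ y]) auto
qed simp

lemma edist_pos:
  assumes "x \<in> Rn n" "y \<in> Rn n" "x \<noteq> y"
  shows "0 < edist n x y"
  using assms edist_eq_0_iff edist_nonneg less_eq_real_def by metis

lemma mat_app_in_Rn [simp]: "mat_app d m G x \<in> Rn d"
  by (simp add: mat_app_def Rn_def)

lemma edist_mat_app_power2:
  "(edist d (mat_app d m G x) (mat_app d m G y))\<^sup>2 = (\<Sum>i<d. (\<Sum>j<m. G (i, j) * (x j - y j))\<^sup>2)"
  unfolding edist_power2
  by (intro sum.cong refl) (simp add: mat_app_def sum_subtractf right_diff_distrib)

section \<open>Existence, uniqueness and comparison of radii\<close>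

text \<open>With truncation at 0 the index set no longer depends on \<open>r\<close>, so the sum is
  visibly continuous and monotone in \<open>r\<close>.\<close>

lemma sum_ball_eq_sum_max:
  assumes "finite Y"
  shows "(\<Sum>q | q \<in> Y \<and> edist n p q \<le> r. r - edist n p q) = (\<Sum>q\<in>Y. max 0 (r - edist n p q))"
proof -
  have "(\<Sum>q | q \<in> Y \<and> edist n p q \<le> r. r - edist n p q)
      = (\<Sum>q\<in>Y. if edist n p q \<le> r then r - edist n p q else 0)"
    using assms by (simp add: sum.If_cases Int_def)
  also have "\<dots> = (\<Sum>q\<in>Y. max 0 (r - edist n p q))"
    by (intro sum.cong) auto
  finally show ?thesis .
qed

lemma sum_max_strict_mono:
  assumes "finite Y" "p \<in> Y" "0 \<le> r" "r < s"
  shows "(\<Sum>q\<in>Y. max 0 (r - edist n p q)) < (\<Sum>q\<in>Y. max 0 (s - edist n p q))"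
proof (rule sum_strict_mono_ex1)
  show "\<exists>q\<in>Y. max 0 (r - edist n p q) < max 0 (s - edist n p q)"
    using assms by (intro bexI[of _ p]) auto
qed (use assms in auto)

lemma radius_properties:
  assumes Y: "finite Y" and p: "p \<in> Y"
  shows radius_pos: "radius n Y p > 0"
    and radius_sum: "(\<Sum>q\<in>Y. max 0 (radius n Y p - edist n p q)) = 1"
proof -
  let ?g = "\<lambda>r. \<Sum>q\<in>Y. max 0 (r - edist n p q)"
  \<comment> \<open>Intermediate values on [0,1]: at 1 the term \<open>q = p\<close> alone already
    contributes 1.\<close>
  have "\<exists>r\<ge>0. r \<le> 1 \<and> ?g r = 1"
  proof (rule IVT')
    have "?g 0 = 0" by (intro sum.neutral) auto
    then show "?g 0 \<le> 1" by simp
    have "max 0 (1 - edist n p p) \<le> ?g 1" by (rule member_le_sum) (use assms in auto)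
    then show "1 \<le> ?g 1" by simp
    show "continuous_on {0..1} ?g" by (intro continuous_intros)
  qed auto
  then obtain r where r: "r \<ge> 0" "?g r = 1" by blast
  moreover have "r \<noteq> 0"
  proof
    assume "r = 0"
    then have "?g r = 0" by (intro sum.neutral) auto
    then show False using r by simp
  qed
  moreover have "t = r" if "t > 0" "?g t = 1" for t
    using sum_max_strict_mono[OF Y p, of t r n] sum_max_strict_mono[OF Y p, of r t n] that r
    by (cases t r rule: linorder_cases) auto
  ultimately have "\<exists>!r. r > 0 \<and> ?g r = 1"
    by (intro ex1I[of _ r]) auto
  then have "radius n Y p > 0 \<and> ?g (radius n Y p) = 1"
    unfolding radius_def sum_ball_eq_sum_max[OF Y] by (rule theI')
  then show "radius n Y p > 0" and "?g (radius n Y p) = 1" by auto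
qed

text \<open>Strict monotonicity turns any \<open>R\<close> at which the sum has reached 1 into an
  upper bound. The later bounds on radii come from this test.\<close>

lemma radius_le:
  assumes "finite Y" "p \<in> Y" "0 \<le> R" "1 \<le> (\<Sum>q\<in>Y. max 0 (R - edist n p q))"
  shows "radius n Y p \<le> R"
proof (rule ccontr)
  assume "\<not> radius n Y p \<le> R"
  then show False
    using sum_max_strict_mono[of Y p R "radius n Y p" n] radius_sum[of Y p n] assms by simp
qed

text \<open>Moving the centre from \<open>f\<close> to \<open>p\<close> while enlarging the radius
  by \<open>edist n p f\<close> decreases no term of the sum, by the triangle inequality.\<close>

lemma radius_lipschitz:
  assumes "finite Y" "p \<in> Y" "f \<in> Y"
  shows "radius n Y p \<le> radius n Y f + edist n p f"
proof (rule radius_le)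
  have "1 = (\<Sum>q\<in>Y. max 0 (radius n Y f - edist n f q))" using radius_sum[OF assms(1,3), of n] by simp
  also have "\<dots> \<le> (\<Sum>q\<in>Y. max 0 (radius n Y f + edist n p f - edist n p q))"
  proof (rule sum_mono)
    fix q
    show "max 0 (radius n Y f - edist n f q) \<le> max 0 (radius n Y f + edist n p f - edist n p q)"
      using edist_triangle[of n p q f] by auto
  qed
  finally show "1 \<le> (\<Sum>q\<in>Y. max 0 (radius n Y f + edist n p f - edist n p q))" .
  show "0 \<le> radius n Y f + edist n p f" using radius_pos[OF assms(1,3), of n] by (simp add: less_imp_le)
qed (use assms in auto)

section \<open>Radii against facility location costs and under maps\<close>

text \<open>Averaging over the cluster bounds the radius of \<open>f\<close>, and the Lipschitz
  property carries this to the other points. Each distance is counted once in each of the two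
  steps.\<close>

lemma sum_radius_le_cluster:
  assumes Y: "finite Y" and f: "f \<in> Y" and P: "P \<subseteq> Y"
  shows "(\<Sum>p\<in>P. radius n Y p) \<le> 1 + 2 * (\<Sum>p\<in>P. edist n p f)"
proof (cases "P = {}")
  case False
  define D where "D = (\<Sum>p\<in>P. edist n p f)"
  have finP: "finite P" using Y P finite_subset by blast
  \<comment> \<open>Chosen so that the terms \<open>R - edist n f q\<close> over \<open>P\<close>
    add up to exactly 1.\<close>
  define R where "R = (1 + D) / card P"
  have c: "real (card P) > 0" using False finP by (simp add: card_gt_0_iff)
  have D: "D \<ge> 0" by (simp add: D_def sum_nonneg)
  have "radius n Y f \<le> R"
  proof (rule radius_le[OF Y f])
    show "0 \<le> R" using D by (simp add: R_def)
    have "1 = card P * R - D" using c by (simp add: R_def)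
    also have "\<dots> = (\<Sum>q\<in>P. R - edist n f q)" by (simp add: D_def sum_subtractf edist_commute)
    also have "\<dots> \<le> (\<Sum>q\<in>P. max 0 (R - edist n f q))" by (intro sum_mono) auto
    also have "\<dots> \<le> (\<Sum>q\<in>Y. max 0 (R - edist n f q))" using Y P by (intro sum_mono2) auto
    finally show "1 \<le> (\<Sum>q\<in>Y. max 0 (R - edist n f q))" .
  qed
  then have "radius n Y p \<le> R + edist n p f" if "p \<in> P" for p
    using radius_lipschitz[OF Y _ f, of p n] P that by auto
  then have "(\<Sum>p\<in>P. radius n Y p) \<le> (\<Sum>p\<in>P. R + edist n p f)"
    by (intro sum_mono) auto
  also have "\<dots> = 1 + 2 * D" using c by (simp add: sum.distrib R_def D_def)
  finally show ?thesis by (simp add: D_def)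
qed simp

text \<open>Cluster the points by a nearest facility \<open>c p\<close>. The cluster bounds add up
  to \<open>card S\<close> plus twice the connection cost.\<close>

lemma sum_radius_le_cost:
  assumes Y: "finite Y" and S: "fl_solution Y S"
  shows "(\<Sum>p\<in>Y. radius n Y p) \<le> 2 * fl_cost n Y S"
proof -
  have finS: "finite S" and S: "S \<noteq> {}" "S \<subseteq> Y"
    using assms finite_subset by (auto simp: fl_solution_def)
  have "\<exists>f\<in>S. edist n p f = Min ((\<lambda>f. edist n p f) ` S)" for p
    using Min_in[of "(\<lambda>f. edist n p f) ` S"] finS S by (simp add: image_iff) (metis)
  then obtain c where c: "\<And>p. c p \<in> S" "\<And>p. edist n p (c p) = Min ((\<lambda>f. edist n p f) ` S)"
    by metis
  have "(\<Sum>p\<in>Y. radius n Y p) = (\<Sum>f\<in>S. \<Sum>p | p \<in> Y \<and> c p = f. radius n Y p)"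
    using c by (intro sum.group[symmetric] Y finS) auto
  also have "\<dots> \<le> (\<Sum>f\<in>S. 1 + 2 * (\<Sum>p | p \<in> Y \<and> c p = f. edist n p f))"
    using S by (intro sum_mono sum_radius_le_cluster Y) auto
  also have "\<dots> = card S + 2 * (\<Sum>f\<in>S. \<Sum>p | p \<in> Y \<and> c p = f. edist n p (c p))"
    by (simp add: sum.distrib sum_distrib_left)
  also have "(\<Sum>f\<in>S. \<Sum>p | p \<in> Y \<and> c p = f. edist n p (c p)) = (\<Sum>p\<in>Y. edist n p (c p))"
    using c by (intro sum.group Y finS) auto
  also have "real (card S) + 2 * (\<Sum>p\<in>Y. edist n p (c p)) \<le> 2 * fl_cost n Y S"
    by (simp add: fl_cost_def c)
  finally show ?thesis .
qed

lemma sum_radius_le_opt: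
  assumes Y: "finite Y" "Y \<noteq> {}"
  shows "(\<Sum>p\<in>Y. radius n Y p) \<le> 2 * fl_opt n Y"
proof -
  have "fl_opt n Y \<in> fl_cost n Y ` {F. fl_solution Y F}"
    unfolding fl_opt_def
  proof (rule Min_in)
    have "{F. fl_solution Y F} \<subseteq> Pow Y" by (auto simp: fl_solution_def)
    then show "finite (fl_cost n Y ` {F. fl_solution Y F})"
      using Y finite_subset by blast
    have "fl_solution Y Y" using Y by (simp add: fl_solution_def)
    then show "fl_cost n Y ` {F. fl_solution Y F} \<noteq> {}" by auto
  qed
  then show ?thesis using sum_radius_le_cost[OF Y(1)] by auto
qed

text \<open>At the enlarged radius the image of each point of the original ball contributes at least
  \<open>radius n Y p\<close>, hence at least its original term. Injectivity keeps these
  contributions separate. Thus expansion inside one ball controls the projected radius.\<close>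

lemma radius_image_le:
  assumes Y: "finite Y" and p: "p \<in> Y" and inj: "inj_on g Y"
    and \<mu>: "\<And>q. q \<in> rel_ball n Y p (radius n Y p) \<Longrightarrow> edist k (g p) (g q) \<le> \<mu>"
  shows "radius k (g ` Y) (g p) \<le> radius n Y p + \<mu>"
proof (rule radius_le)
  define s where "s = radius n Y p"
  define B where "B = rel_ball n Y p s"
  have B: "finite B" "B \<subseteq> Y" using Y by (auto simp: B_def rel_ball_def)
  have s: "s > 0" using radius_pos[OF Y p] by (simp add: s_def)
  have "p \<in> B" using p s by (simp add: B_def rel_ball_def)
  then have "0 \<le> \<mu>" using \<mu>[of p] by (simp add: B_def s_def)
  then show "0 \<le> radius n Y p + \<mu>" using s by (simp add: s_def)
  have "1 = (\<Sum>q\<in>B. s - edist n p q)"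
    using radius_sum[OF Y p, of n] sum_ball_eq_sum_max[OF Y, where n = n and p = p and r = s]
    by (simp add: B_def rel_ball_def s_def)
  also have "\<dots> \<le> (\<Sum>q\<in>B. max 0 (s + \<mu> - edist k (g p) (g q)))"
  proof (rule sum_mono)
    fix q assume "q \<in> B"
    then have "edist k (g p) (g q) \<le> \<mu>" using \<mu> by (simp add: B_def s_def)
    then show "s - edist n p q \<le> max 0 (s + \<mu> - edist k (g p) (g q))"
      using edist_nonneg[of n p q] by linarith
  qed
  also have "\<dots> \<le> (\<Sum>q\<in>Y. max 0 (s + \<mu> - edist k (g p) (g q)))"
    using B Y by (intro sum_mono2) auto
  also have "\<dots> = (\<Sum>q\<in>g ` Y. max 0 (s + \<mu> - edist k (g p) q))"
    by (simp add: sum.reindex[OF inj])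
  finally show "1 \<le> (\<Sum>q\<in>g ` Y. max 0 (radius n Y p + \<mu> - edist k (g p) q))" by (simp add: s_def)
qed (use Y p in auto)

section \<open>Gaussian matrices\<close>

lemma prob_space_gaussian_matrix: "prob_space (gaussian_matrix d m)" if "d \<ge> 1"
  unfolding gaussian_matrix_def
  by (intro prob_space_PiM prob_space_normal_density) (use that in auto)

lemma measurable_gaussian_entry [measurable]:
  "i < d \<Longrightarrow> j < m \<Longrightarrow> (\<lambda>G. G (i, j)) \<in> borel_measurable (gaussian_matrix d m)"
proof -
  assume "i < d" "j < m"
  then have "(\<lambda>G. G (i, j)) \<in> measurable (gaussian_matrix d m) (density lborel (normal_density 0 (sqrt (1 / real d))))"
    unfolding gaussian_matrix_def by (intro measurable_component_singleton) auto
  then show ?thesis by simp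
qed

lemma measurable_edist_mat_app [measurable]:
  "(\<lambda>G. edist d (mat_app d m G x) (mat_app d m G y)) \<in> borel_measurable (gaussian_matrix d m)"
proof -
  have "(\<lambda>G. sqrt (\<Sum>i<d. (\<Sum>j<m. G (i, j) * (x j - y j))\<^sup>2)) \<in> borel_measurable (gaussian_matrix d m)"
    by (intro borel_measurable_sqrt borel_measurable_sum borel_measurable_power borel_measurable_times
        borel_measurable_const measurable_compose[OF _ borel_measurable_sqrt] measurable_gaussian_entry) auto
  moreover have "(\<lambda>G. edist d (mat_app d m G x) (mat_app d m G y))
      = (\<lambda>G. sqrt (\<Sum>i<d. (\<Sum>j<m. G (i, j) * (x j - y j))\<^sup>2))"
    by (intro ext) (metis edist_mat_app_power2 edist_nonneg real_sqrt_abs abs_of_nonneg)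
  ultimately show ?thesis by simp
qed

lemma indep_vars_gaussian_matrix:
  assumes d: "d \<ge> 1"
  shows "prob_space.indep_vars (gaussian_matrix d m) (\<lambda>_. borel) (\<lambda>ij G. G ij) ({..<d} \<times> {..<m})"
\<comment> \<open>The criterion "joint law equals product of the marginals" is applied to a nonempty
  index set only, so the empty one is treated apart.\<close>
proof (cases "m = 0")
  case True
  interpret prob_space "gaussian_matrix d m" by (rule prob_space_gaussian_matrix[OF d])
  have "{..<d} \<times> {..<m} = {}" using True by simp
  then show ?thesis by (simp only: indep_vars_def indep_sets_def) simp
next
  case False
  interpret prob_space "gaussian_matrix d m" by (rule prob_space_gaussian_matrix[OF d])
  let ?I = "{..<d} \<times> {..<m}"
  let ?N = "density lborel (normal_density 0 (sqrt (1 / real d)))"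
  have "distr (gaussian_matrix d m) (\<Pi>\<^sub>M ij\<in>?I. borel) (\<lambda>G. \<lambda>ij\<in>?I. G ij)
      = distr (gaussian_matrix d m) (gaussian_matrix d m) (\<lambda>G. G)"
  proof (rule distr_cong)
    show "sets (\<Pi>\<^sub>M ij\<in>?I. borel) = sets (gaussian_matrix d m)"
      unfolding gaussian_matrix_def by (intro sets_PiM_cong) auto
  qed (auto simp: gaussian_matrix_def space_PiM PiE_restrict)
  also have "\<dots> = (\<Pi>\<^sub>M ij\<in>?I. ?N)" by (simp add: gaussian_matrix_def)
  also have "\<dots> = (\<Pi>\<^sub>M ij\<in>?I. distr (gaussian_matrix d m) borel (\<lambda>G. G ij))"
  proof (rule PiM_cong[OF refl])
    fix ij assume ij: "ij \<in> ?I"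
    have "distr (gaussian_matrix d m) borel (\<lambda>G. G ij) = distr (gaussian_matrix d m) ?N (\<lambda>G. G ij)"
      by (rule distr_cong) auto
    also have "\<dots> = ?N"
      unfolding gaussian_matrix_def
      using distr_PiM_component[of ?I "\<lambda>_. ?N" ij] ij d prob_space_normal_density by simp
    finally show "?N = distr (gaussian_matrix d m) borel (\<lambda>G. G ij)" ..
  qed
  finally show ?thesis
    using False d by (subst indep_vars_iff_distr_eq_PiM') (auto simp: measurable_gaussian_entry lessThan_empty_iff)
qed

lemma distributed_gaussian_entry:
  assumes "i < d" "j < m"
  shows "distributed (gaussian_matrix d m) lborel (\<lambda>G. G (i, j)) (normal_density 0 (sqrt (1 / real d)))"
proof -
  let ?N = "density lborel (normal_density 0 (sqrt (1 / real d)))"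
  have "distr (gaussian_matrix d m) lborel (\<lambda>G. G (i, j)) = distr (gaussian_matrix d m) ?N (\<lambda>G. G (i, j))"
    by (rule distr_cong) auto
  also have "\<dots> = ?N"
    unfolding gaussian_matrix_def
    using distr_PiM_component[of "{..<d} \<times> {..<m}" "\<lambda>_. ?N" "(i, j)"] assms prob_space_normal_density by simp
  finally show ?thesis
    using assms by (simp add: distributed_def)
qed

lemma distributed_gaussian_row:
  assumes i: "i < d" and v: "(\<Sum>j<m. (v j)\<^sup>2) > 0"
  shows "distributed (gaussian_matrix d m) lborel (\<lambda>G. \<Sum>j<m. G (i, j) * v j)
           (normal_density 0 (sqrt ((\<Sum>j<m. (v j)\<^sup>2) / real d)))"
proof -
  have d: "d \<ge> 1" using i by simp
  interpret prob_space "gaussian_matrix d m" by (rule prob_space_gaussian_matrix[OF d])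
  \<comment> \<open>Coordinates with \<open>v j = 0\<close> are dropped, because the normal summands
    must have positive standard deviation.\<close>
  define J where "J = {j. j < m \<and> v j \<noteq> 0}"
  have J: "finite J" by (simp add: J_def)
  have J_ne: "J \<noteq> {}"
  proof
    assume "J = {}"
    then have "(\<Sum>j<m. (v j)\<^sup>2) = 0" by (intro sum.neutral) (auto simp: J_def)
    then show False using v by simp
  qed
  have sumJ: "sum f J = sum f {..<m}" if "\<And>j. v j = 0 \<Longrightarrow> f j = 0" for f :: "nat \<Rightarrow> real"
    by (rule sum.mono_neutral_left) (use that in \<open>auto simp: J_def\<close>)
  \<comment> \<open>Independence indexed by pairs is passed to the index \<open>j\<close> through
    the disjoint blocks \<open>{(i, j)}\<close>.\<close>
  have "indep_vars (\<lambda>j. PiM {(i, j)} (\<lambda>_. borel)) (\<lambda>j G. restrict (\<lambda>ij. G ij) {(i, j)}) J"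
    by (rule indep_vars_restrict[OF indep_vars_gaussian_matrix[OF d]])
      (auto simp: J_def i disjoint_family_on_def)
  then have "indep_vars (\<lambda>_. borel) (\<lambda>j G. restrict (\<lambda>ij. G ij) {(i, j)} (i, j) * v j) J"
    by (rule indep_vars_compose2[where Y="\<lambda>j r. r (i, j) * v j"])
      (intro borel_measurable_times borel_measurable_const measurable_component_singleton, simp)
  then have ind: "indep_vars (\<lambda>_. borel) (\<lambda>j G. G (i, j) * v j) J"
    by simp
  have "distributed (gaussian_matrix d m) lborel (\<lambda>G. \<Sum>j\<in>J. G (i, j) * v j)
      (normal_density (\<Sum>j\<in>J. 0) (sqrt (\<Sum>j\<in>J. (\<bar>v j\<bar> * sqrt (1 / real d))\<^sup>2)))"
  proof (rule sum_indep_normal[OF J J_ne ind])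
    fix j assume j: "j \<in> J"
    show "0 < \<bar>v j\<bar> * sqrt (1 / real d)" using j i by (simp add: J_def)
    have "distributed (gaussian_matrix d m) lborel (\<lambda>G. 0 + v j * G (i, j))
       (normal_density (0 + v j * 0) (\<bar>v j\<bar> * sqrt (1 / real d)))"
      by (rule normal_density_affine) (use j i in \<open>auto simp: J_def intro: distributed_gaussian_entry\<close>)
    then show "distributed (gaussian_matrix d m) lborel (\<lambda>G. G (i, j) * v j)
       (normal_density 0 (\<bar>v j\<bar> * sqrt (1 / real d)))"
      by (simp add: mult.commute)
  qed
  moreover have "(\<Sum>j\<in>J. (\<bar>v j\<bar> * sqrt (1 / real d))\<^sup>2) = (\<Sum>j<m. (v j)\<^sup>2) / real d"
    by (subst sumJ) (auto simp: power_mult_distrib sum_divide_distrib)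
  ultimately show ?thesis
    by (simp add: sumJ)
qed

section \<open>Moments and small ball estimates for a single vector\<close>

text \<open>Exponential tilting: the factor turns the density into a multiple of the normal density
  of variance \<open>\<sigma>\<^sup>2 / (1 - 2 * u)\<close>, whose total mass is 1.\<close>

lemma nn_integral_exp_square_normal:
  fixes X :: "'a \<Rightarrow> real"
  assumes X: "distributed M lborel X (normal_density 0 \<sigma>)" and \<sigma>: "\<sigma> > 0" and u: "u < 1 / 2"
  shows "(\<integral>\<^sup>+\<omega>. ennreal (exp (u * (X \<omega>)\<^sup>2 / \<sigma>\<^sup>2)) \<partial>M) = ennreal (1 / sqrt (1 - 2 * u))"
proof -
  define \<tau> where "\<tau> = \<sigma> / sqrt (1 - 2 * u)"
  have \<tau>: "\<tau> > 0" using \<sigma> u by (simp add: \<tau>_def)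
  have \<tau>2: "\<tau>\<^sup>2 = \<sigma>\<^sup>2 / (1 - 2 * u)" using u by (simp add: \<tau>_def power_divide)
  have dens: "normal_density 0 \<sigma> x * exp (u * x\<^sup>2 / \<sigma>\<^sup>2) = 1 / sqrt (1 - 2 * u) * normal_density 0 \<tau> x" for x
  proof -
    have "exp (- x\<^sup>2 / (2 * \<sigma>\<^sup>2)) * exp (u * x\<^sup>2 / \<sigma>\<^sup>2) = exp (- x\<^sup>2 / (2 * \<tau>\<^sup>2))"
      unfolding exp_add[symmetric] \<tau>2 using \<sigma> u by (simp add: divide_simps) (simp add: algebra_simps)
    moreover have "sqrt (2 * pi * \<tau>\<^sup>2) = sqrt (2 * pi * \<sigma>\<^sup>2) / sqrt (1 - 2 * u)"
      by (simp add: \<tau>2 real_sqrt_divide real_sqrt_mult)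
    ultimately show ?thesis
      using u by (simp add: normal_density_def)
  qed
  have "(\<integral>\<^sup>+\<omega>. ennreal (exp (u * (X \<omega>)\<^sup>2 / \<sigma>\<^sup>2)) \<partial>M)
      = (\<integral>\<^sup>+x. ennreal (normal_density 0 \<sigma> x) * ennreal (exp (u * x\<^sup>2 / \<sigma>\<^sup>2)) \<partial>lborel)"
    by (rule distributed_nn_integral[OF X, symmetric]) simp
  also have "\<dots> = (\<integral>\<^sup>+x. ennreal (1 / sqrt (1 - 2 * u)) * ennreal (normal_density 0 \<tau> x) \<partial>lborel)"
    using u by (intro nn_integral_cong) (simp add: ennreal_mult'[symmetric] dens)
  also have "\<dots> = ennreal (1 / sqrt (1 - 2 * u)) * (\<integral>\<^sup>+x. ennreal (normal_density 0 \<tau> x) \<partial>lborel)"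
    by (rule nn_integral_cmult) simp
  also have "(\<integral>\<^sup>+x. ennreal (normal_density 0 \<tau> x) \<partial>lborel) = 1"
    using \<tau> by (subst nn_integral_eq_integral) auto
  finally show ?thesis by simp
qed

text \<open>The exponent is \<open>u\<close> times a chi-square variable with \<open>d\<close>
  degrees of freedom, one for each independent row, so this is its moment generating function.
  \<open>u = 1 / 4\<close> yields moments, negative \<open>u\<close> the small ball bound.\<close>

lemma gaussian_exp_moment:
  fixes x y :: "nat \<Rightarrow> real"
  assumes d: "d \<ge> 1" and xy: "edist m x y > 0" and u: "u < 1 / 2"
  defines "f \<equiv> \<lambda>G. exp (u * d * (edist d (mat_app d m G x) (mat_app d m G y))\<^sup>2 / (edist m x y)\<^sup>2)"
  shows "integrable (gaussian_matrix d m) f"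
    and "(\<integral>G. f G \<partial>gaussian_matrix d m) = (1 / sqrt (1 - 2 * u)) ^ d"
proof -
  interpret prob_space "gaussian_matrix d m" by (rule prob_space_gaussian_matrix[OF d])
  define v where "v = (\<lambda>j. x j - y j)"
  have v: "(\<Sum>j<m. (v j)\<^sup>2) = (edist m x y)\<^sup>2" by (simp add: v_def edist_power2)
  define \<sigma> where "\<sigma> = sqrt ((\<Sum>j<m. (v j)\<^sup>2) / real d)"
  have \<sigma>: "\<sigma> > 0" using xy d by (simp add: \<sigma>_def v)
  have \<sigma>2: "\<sigma>\<^sup>2 = (edist m x y)\<^sup>2 / real d" by (simp add: \<sigma>_def v)
  let ?Z = "\<lambda>i G. \<Sum>j<m. G (i, j) * v j"
  have f: "f G = (\<Prod>i<d. exp (u * (?Z i G)\<^sup>2 / \<sigma>\<^sup>2))" for G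
    unfolding f_def edist_mat_app_power2 \<sigma>2 v_def
    using d by (simp add: exp_sum[symmetric] sum_distrib_left sum_divide_distrib mult_ac)
  have dist: "distributed (gaussian_matrix d m) lborel (?Z i) (normal_density 0 \<sigma>)" if "i < d" for i
    unfolding \<sigma>_def by (rule distributed_gaussian_row) (use that xy in \<open>auto simp: v\<close>)
  have "indep_vars (\<lambda>i. PiM ({i} \<times> {..<m}) (\<lambda>_. borel)) (\<lambda>i G. restrict (\<lambda>ij. G ij) ({i} \<times> {..<m})) {..<d}"
    by (rule indep_vars_restrict[OF indep_vars_gaussian_matrix[OF d]])
      (auto simp: disjoint_family_on_def)
  then have "indep_vars (\<lambda>_. borel) (\<lambda>i G. ennreal (exp (u * (\<Sum>j<m. restrict (\<lambda>ij. G ij) ({i} \<times> {..<m}) (i, j) * v j)\<^sup>2 / \<sigma>\<^sup>2))) {..<d}"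
    by (rule indep_vars_compose2
        [where Y="\<lambda>i r. ennreal (exp (u * (\<Sum>j<m. r (i, j) * v j)\<^sup>2 / \<sigma>\<^sup>2))"]) measurable
  then have ind: "indep_vars (\<lambda>_. borel) (\<lambda>i G. ennreal (exp (u * (?Z i G)\<^sup>2 / \<sigma>\<^sup>2))) {..<d}"
    by simp
  have "(\<integral>\<^sup>+G. ennreal (f G) \<partial>gaussian_matrix d m)
      = (\<integral>\<^sup>+G. (\<Prod>i<d. ennreal (exp (u * (?Z i G)\<^sup>2 / \<sigma>\<^sup>2))) \<partial>gaussian_matrix d m)"
    by (simp add: f prod_ennreal)
  also have "\<dots> = (\<Prod>i<d. \<integral>\<^sup>+G. ennreal (exp (u * (?Z i G)\<^sup>2 / \<sigma>\<^sup>2)) \<partial>gaussian_matrix d m)"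
    by (rule indep_vars_nn_integral[OF _ ind]) auto
  also have "\<dots> = (\<Prod>i<d. ennreal (1 / sqrt (1 - 2 * u)))"
    by (intro prod.cong refl nn_integral_exp_square_normal dist) (use \<sigma> u in auto)
  also have "\<dots> = ennreal ((1 / sqrt (1 - 2 * u)) ^ d)"
    using u by (simp add: ennreal_power)
  finally have nn: "(\<integral>\<^sup>+G. ennreal (f G) \<partial>gaussian_matrix d m) = ennreal ((1 / sqrt (1 - 2 * u)) ^ d)" .
  have meas: "f \<in> borel_measurable (gaussian_matrix d m)"
    unfolding f_def by measurable
  show "integrable (gaussian_matrix d m) f"
    by (rule integrableI_nonneg[OF meas]) (auto simp: nn[unfolded f_def] f_def)
  show "(\<integral>G. f G \<partial>gaussian_matrix d m) = (1 / sqrt (1 - 2 * u)) ^ d"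
    using nn u meas by (intro integral_eq_nn_integral[THEN trans]) (auto simp: f_def)
qed

text \<open>The inequality \<open>z \<le> exp z\<close> at a quarter of the squared stretch ratio,
  raised to the power \<open>d\<close>, reduces this to the exponential moment at
  \<open>u = 1 / 4\<close>. The resulting base is 4 sqrt 2 < 6.\<close>

lemma gaussian_moment:
  fixes m d :: nat and x y :: "nat \<Rightarrow> real"
  assumes d: "d \<ge> 1"
  defines "f \<equiv> \<lambda>G::nat \<times> nat \<Rightarrow> real. edist d (mat_app d m G x) (mat_app d m G y) ^ (2 * d)"
  shows "integrable (gaussian_matrix d m) f"
    and "(\<integral>G. f G \<partial>gaussian_matrix d m) \<le> 6 ^ d * edist m x y ^ (2 * d)"
proof -
  interpret prob_space "gaussian_matrix d m" by (rule prob_space_gaussian_matrix[OF d])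
  have "integrable (gaussian_matrix d m) f \<and> (\<integral>G. f G \<partial>gaussian_matrix d m) \<le> 6 ^ d * edist m x y ^ (2 * d)"
  proof (cases "edist m x y = 0")
    case True
    then have "x j - y j = 0" if "j < m" for j using that by (simp add: edist_def L2_set_eq_0_iff)
    then have "(edist d (mat_app d m G x) (mat_app d m G y))\<^sup>2 = 0" for G
      unfolding edist_mat_app_power2 by (intro sum.neutral) auto
    then have "f = (\<lambda>_. 0)" using d by (simp add: f_def fun_eq_iff)
    then show ?thesis by simp
  next
    case False
    then have pos: "edist m x y > 0" using edist_nonneg[of m x y] by linarith
    let ?D = "\<lambda>G. edist d (mat_app d m G x) (mat_app d m G y)"
    let ?g = "\<lambda>G. exp (1 / 4 * d * (?D G)\<^sup>2 / (edist m x y)\<^sup>2)"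
    note g = gaussian_exp_moment[OF d pos, of "1 / 4"]
    have int: "integrable (gaussian_matrix d m) (\<lambda>G. 4 ^ d * edist m x y ^ (2 * d) * ?g G)"
      by (intro integrable_mult_right g) auto
    have le: "f G \<le> 4 ^ d * edist m x y ^ (2 * d) * ?g G" for G
    proof -
      have "(?D G)\<^sup>2 / (edist m x y)\<^sup>2 / 4 \<le> exp ((?D G)\<^sup>2 / (edist m x y)\<^sup>2 / 4)"
        using exp_ge_add_one_self[of "(?D G)\<^sup>2 / (edist m x y)\<^sup>2 / 4"] by linarith
      then have "((?D G)\<^sup>2 / (edist m x y)\<^sup>2 / 4) ^ d \<le> exp ((?D G)\<^sup>2 / (edist m x y)\<^sup>2 / 4) ^ d"
        by (intro power_mono) auto
      also have "\<dots> = ?g G" by (simp add: exp_of_nat_mult[symmetric] mult_ac)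
      finally show ?thesis
        using pos by (simp add: f_def power_divide power_mult[symmetric] field_simps)
    qed
    have f_int: "integrable (gaussian_matrix d m) f"
      by (rule Bochner_Integration.integrable_bound[OF int]) (use le in \<open>auto simp: f_def\<close>)
    have "(\<integral>G. f G \<partial>gaussian_matrix d m) \<le> (\<integral>G. 4 ^ d * edist m x y ^ (2 * d) * ?g G \<partial>gaussian_matrix d m)"
      by (intro integral_mono f_int int le)
    also have "\<dots> = 4 ^ d * edist m x y ^ (2 * d) * (\<integral>G. ?g G \<partial>gaussian_matrix d m)"
      by (rule integral_mult_right_zero)
    also have "\<dots> = 4 ^ d * edist m x y ^ (2 * d) * (1 / sqrt (1 / 2)) ^ d"
      by (subst g) auto
    also have "\<dots> = (4 * (1 / sqrt (1 / 2))) ^ d * edist m x y ^ (2 * d)"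
      unfolding power_mult_distrib by simp
    also have "\<dots> \<le> 6 ^ d * edist m x y ^ (2 * d)"
    proof (intro mult_right_mono power_mono)
      have "2 / 3 \<le> sqrt (1 / 2)" by (rule real_le_rsqrt) (simp add: power2_eq_square)
      then show "4 * (1 / sqrt (1 / 2)) \<le> 6" by (simp add: field_simps)
    qed auto
    finally show ?thesis using f_int by simp
  qed
  then show "integrable (gaussian_matrix d m) f"
    and "(\<integral>G. f G \<partial>gaussian_matrix d m) \<le> 6 ^ d * edist m x y ^ (2 * d)" by auto
qed

text \<open>Chernoff bound for the lower tail, keeping the exponential itself as the majorant
  \<open>U\<close>.\<close>

lemma gaussian_small_ball:
  assumes d: "d \<ge> 1" and xy: "edist m x y > 0" and \<tau>: "\<tau> > 0"
  shows "\<exists>U. integrable (gaussian_matrix d m) U \<and> (\<forall>G. 0 \<le> U G) \<and>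
           (\<forall>G. edist d (mat_app d m G x) (mat_app d m G y) \<le> \<tau> \<longrightarrow> 1 \<le> U G) \<and>
           (\<integral>G. U G \<partial>gaussian_matrix d m) \<le> (2 * \<tau> / edist m x y) ^ d"
proof -
  interpret prob_space "gaussian_matrix d m" by (rule prob_space_gaussian_matrix[OF d])
  let ?D = "\<lambda>G. edist d (mat_app d m G x) (mat_app d m G y)"
  define t where "t = \<tau> / edist m x y"
  have t: "t > 0" using xy \<tau> by (simp add: t_def)
  \<comment> \<open>With this \<open>u\<close>, \<open>U G\<close> is
    \<open>exp (d / 2 * (1 - (?D G)\<^sup>2 / \<tau>\<^sup>2))\<close>, which is at least 1 when
    \<open>?D G \<le> \<tau>\<close>. The base of its integral is at most exp(1/2) t \<le> 2
    t.\<close>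
  define u where "u = - 1 / (2 * t\<^sup>2)"
  have u: "u < 0" using t by (simp add: u_def)
  let ?g = "\<lambda>G. exp (u * d * (?D G)\<^sup>2 / (edist m x y)\<^sup>2)"
  define U where "U = (\<lambda>G. exp (d / 2) * ?g G)"
  note g = gaussian_exp_moment[OF d xy, of u]
  have "integrable (gaussian_matrix d m) U" unfolding U_def
    using u by (intro integrable_mult_right g) auto
  moreover have "\<forall>G. 0 \<le> U G" by (simp add: U_def)
  moreover have "1 \<le> U G" if "?D G \<le> \<tau>" for G
  proof -
    have "(?D G)\<^sup>2 \<le> \<tau>\<^sup>2" using that by (intro power_mono) auto
    moreover have "U G = exp (d / 2 * (1 - (?D G)\<^sup>2 / \<tau>\<^sup>2))"
      unfolding U_def exp_add[symmetric] u_def t_def using xy \<tau> by (simp add: field_simps)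
    moreover have "(?D G)\<^sup>2 / \<tau>\<^sup>2 \<le> 1" using calculation(1) \<tau> by (simp add: field_simps)
    ultimately show ?thesis by simp
  qed
  moreover have "(\<integral>G. U G \<partial>gaussian_matrix d m) \<le> (2 * \<tau> / edist m x y) ^ d"
  proof -
    have "(\<integral>G. U G \<partial>gaussian_matrix d m) = exp (d / 2) * (\<integral>G. ?g G \<partial>gaussian_matrix d m)"
      unfolding U_def by (rule integral_mult_right_zero)
    also have "\<dots> = exp (1 / 2) ^ d * (1 / sqrt (1 - 2 * u)) ^ d"
      using u by (subst g) (auto simp: exp_of_nat_mult[symmetric])
    also have "\<dots> = (exp (1 / 2) / sqrt (1 - 2 * u)) ^ d" by (simp add: power_divide)
    also have "\<dots> \<le> (2 * t) ^ d"
    proof (rule power_mono)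
      have "exp (1 / 2 :: real) \<le> 1 + 1 / 2 + (1 / 2)\<^sup>2" by (rule exp_bound) auto
      then have e: "exp (1 / 2 :: real) \<le> 2" by (simp add: power2_eq_square)
      have "1 / t \<le> sqrt (1 - 2 * u)"
        by (rule real_le_rsqrt) (use t in \<open>simp add: u_def power_divide\<close>)
      then have "1 \<le> t * sqrt (1 - 2 * u)" using t by (simp add: field_simps)
      then have "exp (1 / 2) * 1 \<le> 2 * (t * sqrt (1 - 2 * u))" using e by (intro mult_mono) auto
      then show "exp (1 / 2) / sqrt (1 - 2 * u) \<le> 2 * t" using u by (simp add: pos_divide_le_eq)
    qed (use u in auto)
    finally show ?thesis by (simp add: t_def)
  qed
  ultimately show ?thesis by (intro exI[of _ U]) auto
qed

text \<open>For \<open>x \<noteq> y\<close> the first coordinate of the projected difference is a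
  nondegenerate normal variable, hence almost surely nonzero, and there are finitely many
  pairs.\<close>

lemma AE_mat_app_inj_on:
  assumes d: "d \<ge> 1" and X: "finite X" "X \<subseteq> Rn m"
  shows "AE G in gaussian_matrix d m. inj_on (mat_app d m G) X"
proof -
  interpret prob_space "gaussian_matrix d m" by (rule prob_space_gaussian_matrix[OF d])
  have "AE G in gaussian_matrix d m. mat_app d m G x \<noteq> mat_app d m G y"
    if "x \<in> X" "y \<in> X" "x \<noteq> y" for x y
  proof -
    have "0 < edist m x y" by (rule edist_pos) (use that X in auto)
    then have "0 < (edist m x y)\<^sup>2" by simp
    then have pos: "0 < (\<Sum>j<m. (x j - y j)\<^sup>2)" by (simp add: edist_power2)
    have "AE G in gaussian_matrix d m. (\<Sum>j<m. G (0, j) * (x j - y j)) \<noteq> 0"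
      by (subst distributed_AE2[OF distributed_gaussian_row[OF _ pos]])
        (use d AE_lborel_singleton[of 0] in \<open>auto elim: eventually_mono\<close>)
    then show ?thesis
    proof eventually_elim
      case (elim G)
      show ?case
      proof
        assume eq: "mat_app d m G x = mat_app d m G y"
        have "(\<Sum>j<m. G (0, j) * (x j - y j)) = mat_app d m G x 0 - mat_app d m G y 0"
          using d by (simp add: mat_app_def sum_subtractf right_diff_distrib)
        then show False using elim eq by simp
      qed
    qed
  qed
  then have "AE G in gaussian_matrix d m. \<forall>x\<in>X. \<forall>y\<in>X. x \<noteq> y \<longrightarrow> mat_app d m G x \<noteq> mat_app d m G y"
    using X by (auto simp: AE_ball_countable countable_finite)
  then show ?thesis by eventually_elim (auto simp: inj_on_def)
qed

section \<open>Doubling covers\<close>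

lemma doubling_cover:
  assumes X: "finite X" and x: "x \<in> X" and r: "r > 0"
  shows "\<exists>S\<subseteq>X. finite S \<and> card S \<le> doubling_const n X \<and>
           rel_ball n X x r \<subseteq> (\<Union>s\<in>S. rel_ball n X s (r / 2))"
proof -
  let ?P = "\<lambda>l. \<forall>x\<in>X. \<forall>r>0. \<exists>S\<subseteq>X. finite S \<and> card S \<le> l \<and>
        rel_ball n X x r \<subseteq> (\<Union>s\<in>S. rel_ball n X s (r / 2))"
  \<comment> \<open>Some bound is admissible, with \<open>S = X\<close>, so the \<open>LEAST\<close>
    in the definition is attained.\<close>
  have "?P (card X)"
    using X by (intro ballI allI impI exI[of _ X]) (auto simp: rel_ball_def intro!: bexI)
  then have "?P (doubling_const n X)"
    unfolding doubling_const_def by (rule LeastI)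
  then show ?thesis using x r by blast
qed

lemma doubling_cover_iterate:
  assumes X: "finite X" and x: "x \<in> X" and r: "r > 0"
  shows "\<exists>S\<subseteq>X. finite S \<and> card S \<le> doubling_const n X ^ k \<and>
           rel_ball n X x (2 ^ k * r) \<subseteq> (\<Union>s\<in>S. rel_ball n X s r)"
  using x
proof (induction k arbitrary: x)
  case 0
  then show ?case by (intro exI[of _ "{x}"]) auto
next
  case (Suc k)
  let ?l = "doubling_const n X"
  obtain S where S: "S \<subseteq> X" "finite S" "card S \<le> ?l"
    "rel_ball n X x (2 ^ Suc k * r) \<subseteq> (\<Union>s\<in>S. rel_ball n X s (2 ^ Suc k * r / 2))"
    using doubling_cover[OF X Suc.prems, of "2 ^ Suc k * r" n] r by auto
  have "\<exists>T\<subseteq>X. finite T \<and> card T \<le> ?l ^ k \<and>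
      rel_ball n X s (2 ^ k * r) \<subseteq> (\<Union>t\<in>T. rel_ball n X t r)" if "s \<in> S" for s
    using Suc.IH[of s] that S by auto
  then obtain T where T: "\<And>s. s \<in> S \<Longrightarrow> T s \<subseteq> X" "\<And>s. s \<in> S \<Longrightarrow> finite (T s)"
    "\<And>s. s \<in> S \<Longrightarrow> card (T s) \<le> ?l ^ k"
    "\<And>s. s \<in> S \<Longrightarrow> rel_ball n X s (2 ^ k * r) \<subseteq> (\<Union>t\<in>T s. rel_ball n X t r)"
    by metis
  have "card (\<Union>s\<in>S. T s) \<le> (\<Sum>s\<in>S. card (T s))" by (rule card_UN_le[OF S(2)])
  also have "\<dots> \<le> (\<Sum>s\<in>S. ?l ^ k)" by (intro sum_mono T)
  also have "\<dots> \<le> ?l ^ Suc k" using S(3) by simp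
  finally have "card (\<Union>s\<in>S. T s) \<le> ?l ^ Suc k" .
  moreover have "rel_ball n X x (2 ^ Suc k * r) \<subseteq> (\<Union>t\<in>(\<Union>s\<in>S. T s). rel_ball n X t r)"
    using S(4) T(4) by fastforce
  ultimately show ?case
    using S(2) T(1,2) by (intro exI[of _ "\<Union>s\<in>S. T s"]) (simp add: UN_subset_iff)
qed

text \<open>Take the ball about \<open>x\<close> that just reaches a nearest neighbour
  \<open>z\<close>. A half-radius ball containing \<open>x\<close> must be centred at
  \<open>x\<close>, and then it misses \<open>z\<close>, so one ball does not suffice.\<close>

lemma doubling_const_ge_2:
  assumes X: "finite X" "X \<subseteq> Rn n" and xy: "x \<in> X" "y \<in> X" "x \<noteq> y"
  shows "doubling_const n X \<ge> 2"
proof (rule ccontr)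
  assume "\<not> doubling_const n X \<ge> 2"
  let ?N = "{q \<in> X. q \<noteq> x}"
  have N: "finite (edist n x ` ?N)" "edist n x ` ?N \<noteq> {}" using X xy by auto
  then obtain z where "z \<in> ?N" "edist n x z = Min (edist n x ` ?N)"
    using Min_in[OF N] by (metis (no_types, lifting) imageE)
  then have z: "z \<in> ?N" "\<And>q. q \<in> ?N \<Longrightarrow> edist n x z \<le> edist n x q"
    using N(1) by auto
  have pos: "edist n x z > 0" using z X xy by (intro edist_pos) auto
  obtain S where S: "S \<subseteq> X" "finite S" "card S \<le> doubling_const n X"
    "rel_ball n X x (edist n x z) \<subseteq> (\<Union>s\<in>S. rel_ball n X s (edist n x z / 2))"
    using doubling_cover[OF X(1) xy(1) pos] by blast
  have "x \<in> rel_ball n X x (edist n x z)" "z \<in> rel_ball n X x (edist n x z)"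
    using xy z pos by (auto simp: rel_ball_def)
  then have "x \<in> (\<Union>s\<in>S. rel_ball n X s (edist n x z / 2))" "z \<in> (\<Union>s\<in>S. rel_ball n X s (edist n x z / 2))"
    using S(4) by blast+
  then obtain a b where ab: "a \<in> S" "b \<in> S" "edist n a x \<le> edist n x z / 2" "edist n b z \<le> edist n x z / 2"
    unfolding rel_ball_def by blast
  have "card S \<le> 1" using S \<open>\<not> doubling_const n X \<ge> 2\<close> by linarith
  then have "a = b" using ab S by (metis card_le_Suc0_iff_eq One_nat_def)
  have "a = x"
  proof (rule ccontr)
    assume "a \<noteq> x"
    then have "edist n x z \<le> edist n x a" using z ab S by auto
    then show False using ab pos edist_commute[of n x a] by simp
  qed
  then show False using ab \<open>a = b\<close> pos by simp
qed

section \<open>Expansion and contraction of the projection\<close>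

text \<open>Split at \<open>b = 3 * a\<close>. The factor on \<open>b\<close> is 4/3 rather than 2
  so that halving the radius in the chaining still gains: 2 (4/3 * 1/2)^2 = 8/9 < 1, where the 2 is
  the cost of the cover per dimension.\<close>

lemma add_power_le:
  fixes a b :: real
  assumes "0 \<le> a" "0 \<le> b"
  shows "(a + b) ^ k \<le> (4 * a) ^ k + (4 / 3 * b) ^ k"
proof (cases "3 * a \<le> b")
  case True
  then have "(a + b) ^ k \<le> (4 / 3 * b) ^ k" using assms by (intro power_mono) auto
  then show ?thesis using assms by (smt (verit) zero_le_power)
next
  case False
  then have "(a + b) ^ k \<le> (4 * a) ^ k" using assms by (intro power_mono) auto
  then show ?thesis using assms by (smt (verit) zero_le_power divide_nonneg_nonneg mult_nonneg_nonneg)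
qed

lemma finite_separated:
  assumes X: "finite X" "X \<subseteq> Rn n"
  shows "\<exists>\<delta>>0. \<forall>x\<in>X. \<forall>y\<in>X. edist n x y < \<delta> \<longrightarrow> x = y"
proof -
  define E where "E = insert 1 ((\<lambda>(x, y). edist n x y) ` {(x, y) \<in> X \<times> X. x \<noteq> y})"
  have "finite {(x, y) \<in> X \<times> X. x \<noteq> y}" by (rule finite_subset[of _ "X \<times> X"]) (use X in auto)
  then have E: "finite E" "E \<noteq> {}" by (auto simp: E_def)
  have "\<forall>e\<in>E. e > 0" using X by (auto simp: E_def intro!: edist_pos)
  then have "Min E > 0" using E by simp
  moreover have "x = y" if "x \<in> X" "y \<in> X" "edist n x y < Min E" for x y
  proof (rule ccontr)
    assume "x \<noteq> y"
    then have "edist n x y \<in> E" using that by (auto simp: E_def)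
    then show False using that E by (meson Min_le not_le)
  qed
  ultimately show ?thesis by blast
qed

text \<open>
  Chaining in one induction over the scale: the ball is covered by \<open>\<lambda>\<close> balls of half the radius, and
  for the moment of order \<open>2 d\<close> the union over these costs only a factor \<open>\<lambda>\<close>, which \<open>2\<^sup>d\<close> absorbs.
\<close>
lemma gaussian_ball_expansion:
  assumes d: "d \<ge> 1" and X: "finite X" "X \<subseteq> Rn m"
    and dbl: "2 * real (doubling_const m X) \<le> 2 ^ d"
    and x: "x \<in> X" and r: "r > 0"
  shows "\<exists>U. integrable (gaussian_matrix d m) U \<and> (\<forall>G. 0 \<le> U G) \<and>
           (\<forall>G. \<forall>y\<in>rel_ball m X x r. edist d (mat_app d m G x) (mat_app d m G y) ^ (2 * d) \<le> U G) \<and>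
           (\<integral>G. U G \<partial>gaussian_matrix d m) \<le> (30 * r) ^ (2 * d)"
proof -
  let ?M = "gaussian_matrix d m"
  let ?D = "\<lambda>x y G. edist d (mat_app d m G x) (mat_app d m G y)"
  let ?l = "doubling_const m X"
  let ?Q = "\<lambda>x r U. integrable ?M U \<and> (\<forall>G. 0 \<le> U G) \<and>
      (\<forall>G. \<forall>y\<in>rel_ball m X x r. ?D x y G ^ (2 * d) \<le> U G) \<and> (\<integral>G. U G \<partial>?M) \<le> (30 * r) ^ (2 * d)"
  obtain \<delta> where \<delta>: "\<delta> > 0" "\<And>x y. x \<in> X \<Longrightarrow> y \<in> X \<Longrightarrow> edist m x y < \<delta> \<Longrightarrow> x = y"
    using finite_separated[OF X] by blast
  \<comment> \<open>\<open>k\<close> halvings bring the radius below the separation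
    \<open>\<delta>\<close>, where the ball is a single point.\<close>
  have "\<exists>U. ?Q x r U" if "r < 2 ^ k * \<delta>" for k
    using x r that
  proof (induction k arbitrary: x r)
    case 0
    then have "rel_ball m X x r \<subseteq> {x}" using \<delta> by (fastforce simp: rel_ball_def)
    then have "?D x y G = 0" if "y \<in> rel_ball m X x r" for y G
      using that by (metis edist_self singletonD subsetD)
    then show ?case using d by (intro exI[of _ "\<lambda>_. 0"]) (simp add: power_0_left)
  next
    case (Suc k)
    obtain S where S: "S \<subseteq> X" "finite S" "card S \<le> ?l"
      "rel_ball m X x r \<subseteq> (\<Union>s\<in>S. rel_ball m X s (r / 2))"
      using doubling_cover[OF X(1) Suc.prems(1,2)] by blast
    \<comment> \<open>Centres further away cover no point of the ball. Discarding them lets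
      \<open>gaussian_moment\<close> bound the projected distance to the others.\<close>
    define T where "T = {s \<in> S. edist m x s \<le> 3 / 2 * r}"
    have T: "T \<subseteq> X" "finite T" using S by (auto simp: T_def)
    have "card T \<le> card S" using S by (intro card_mono) (auto simp: T_def)
    then have cardT: "real (card T) \<le> ?l" using S by simp
    have "\<exists>U. ?Q s (r / 2) U" if "s \<in> T" for s
      using Suc.IH[of s "r / 2"] Suc.prems T that by auto
    then obtain V where V: "\<And>s. s \<in> T \<Longrightarrow> ?Q s (r / 2) (V s)"
      by metis
    define U where "U = (\<lambda>G. \<Sum>s\<in>T. 4 ^ (2 * d) * ?D x s G ^ (2 * d) + (4 / 3) ^ (2 * d) * V s G)"
    have int: "integrable ?M (\<lambda>G. 4 ^ (2 * d) * ?D x s G ^ (2 * d))"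
      "integrable ?M (\<lambda>G. (4 / 3) ^ (2 * d) * V s G)" if "s \<in> T" for s
      using V[OF that] gaussian_moment(1)[OF d] by auto
    have "integrable ?M U" unfolding U_def
      by (intro Bochner_Integration.integrable_sum Bochner_Integration.integrable_add int)
    moreover have term_nonneg: "0 \<le> 4 ^ (2 * d) * ?D x s G ^ (2 * d) + (4 / 3) ^ (2 * d) * V s G" if "s \<in> T" for s G
      using V[OF that] by (intro add_nonneg_nonneg mult_nonneg_nonneg) auto
    then have "\<forall>G. 0 \<le> U G" by (auto simp: U_def intro!: sum_nonneg)
    moreover have "?D x y G ^ (2 * d) \<le> U G" if y: "y \<in> rel_ball m X x r" for y G
    proof -
      obtain s where s: "s \<in> S" "y \<in> rel_ball m X s (r / 2)" using S(4) y by blast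
      have "edist m x s \<le> edist m x y + edist m y s" by (rule edist_triangle)
      also have "\<dots> \<le> r + r / 2"
        using s y by (intro add_mono) (auto simp: rel_ball_def edist_commute)
      finally have sT: "s \<in> T" using s by (simp add: T_def)
      have "?D x y G ^ (2 * d) \<le> (?D x s G + ?D s y G) ^ (2 * d)"
        by (intro power_mono edist_triangle) auto
      also have "\<dots> \<le> (4 * ?D x s G) ^ (2 * d) + (4 / 3 * ?D s y G) ^ (2 * d)"
        by (rule add_power_le) auto
      also have "\<dots> \<le> 4 ^ (2 * d) * ?D x s G ^ (2 * d) + (4 / 3) ^ (2 * d) * V s G"
        unfolding power_mult_distrib using V[OF sT] s by (intro add_mono mult_left_mono) auto
      also have "\<dots> \<le> U G" unfolding U_def
        by (rule member_le_sum[OF sT]) (use term_nonneg T in auto)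
      finally show ?thesis .
    qed
    moreover have "(\<integral>G. U G \<partial>?M) \<le> (30 * r) ^ (2 * d)"
    proof -
      have "(\<integral>G. U G \<partial>?M) = (\<Sum>s\<in>T. (\<integral>G. 4 ^ (2 * d) * ?D x s G ^ (2 * d) \<partial>?M) + (\<integral>G. (4 / 3) ^ (2 * d) * V s G \<partial>?M))"
        unfolding U_def
        by (subst Bochner_Integration.integral_sum) (intro Bochner_Integration.integrable_add int sum.cong
            refl Bochner_Integration.integral_add; assumption)+
      \<comment> \<open>Bases of the \<open>d\<close>-th powers: 4^2 * 6 * (3/2)^2 = 216 \<le> 400
        for the first term and (4/3)^2 * 15^2 = 400 for the second. The factor
        \<open>2 * card T\<close> costs at most \<open>2 ^ d\<close>, and 800 \<le> 900 =
        30^2.\<close>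
      also have "\<dots> \<le> (\<Sum>s\<in>T. 2 * (400 ^ d * r ^ (2 * d)))"
      proof (rule sum_mono)
        fix s assume s: "s \<in> T"
        have "(\<integral>G. 4 ^ (2 * d) * ?D x s G ^ (2 * d) \<partial>?M) = 4 ^ (2 * d) * (\<integral>G. ?D x s G ^ (2 * d) \<partial>?M)"
          by (rule integral_mult_right_zero)
        also have "\<dots> \<le> 4 ^ (2 * d) * (6 ^ d * (3 / 2 * r) ^ (2 * d))"
        proof (intro mult_left_mono order_trans[OF gaussian_moment(2)[OF d]] power_mono)
          show "edist m x s \<le> 3 / 2 * r" using s by (simp add: T_def)
        qed auto
        also have "\<dots> = 216 ^ d * r ^ (2 * d)"
          unfolding power_mult power_mult_distrib[symmetric] by (simp add: power2_eq_square)
        also have "\<dots> \<le> 400 ^ d * r ^ (2 * d)"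
          using Suc.prems by (intro mult_right_mono power_mono) auto
        finally have 1: "(\<integral>G. 4 ^ (2 * d) * ?D x s G ^ (2 * d) \<partial>?M) \<le> 400 ^ d * r ^ (2 * d)" .
        have "(\<integral>G. (4 / 3) ^ (2 * d) * V s G \<partial>?M) = (4 / 3) ^ (2 * d) * (\<integral>G. V s G \<partial>?M)"
          by (rule integral_mult_right_zero)
        also have "\<dots> \<le> (4 / 3) ^ (2 * d) * (30 * (r / 2)) ^ (2 * d)"
          using V[OF s] by (intro mult_left_mono) auto
        also have "\<dots> = 400 ^ d * r ^ (2 * d)"
          unfolding power_mult power_mult_distrib[symmetric] by (simp add: power2_eq_square)
        finally show "(\<integral>G. 4 ^ (2 * d) * ?D x s G ^ (2 * d) \<partial>?M) + (\<integral>G. (4 / 3) ^ (2 * d) * V s G \<partial>?M)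
            \<le> 2 * (400 ^ d * r ^ (2 * d))" using 1 by simp
      qed
      also have "\<dots> = (2 * real (card T)) * (400 ^ d * r ^ (2 * d))" by simp
      also have "\<dots> \<le> 2 ^ d * (400 ^ d * r ^ (2 * d))"
        using cardT dbl Suc.prems by (intro mult_right_mono) auto
      also have "\<dots> = 800 ^ d * r ^ (2 * d)" by (simp add: power_mult_distrib[symmetric])
      also have "\<dots> \<le> 900 ^ d * r ^ (2 * d)"
        using Suc.prems by (intro mult_right_mono power_mono) auto
      also have "\<dots> = (30 * r) ^ (2 * d)"
        unfolding power_mult power_mult_distrib[symmetric] by (simp add: power2_eq_square)
      finally show ?thesis .
    qed
    ultimately show ?case by (intro exI[of _ U]) blast
  qed
  moreover obtain k :: nat where "r / \<delta> < 2 ^ k" using real_arch_pow[of 2 "r / \<delta>"] by auto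
  then have "r < 2 ^ k * \<delta>" using \<delta> by (simp add: pos_divide_less_eq)
  ultimately show ?thesis by blast
qed

section \<open>Union bound over the net, first for one annulus, then over all scales\<close>

text \<open>\<open>W\<close> adds an expansion term for \<open>p\<close> and, for each net point, a
  contraction and an expansion term. The decay in \<open>32 ^ j\<close> is to beat the growth
  \<open>16 ^ j\<close> of the distances.\<close>

lemma gaussian_annulus:
  assumes d: "d \<ge> 5" and X: "finite X" "X \<subseteq> Rn m"
    and dbl: "2 \<le> doubling_const m X" "doubling_const m X ^ 8 \<le> 2 ^ d"
    and p: "p \<in> X"
  defines "s \<equiv> radius m X p"
  shows "\<exists>W :: (nat \<times> nat \<Rightarrow> real) \<Rightarrow> real. integrable (gaussian_matrix d m) W \<and> (\<forall>G. 0 \<le> W G) \<and>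
     (\<forall>G. \<forall>x\<in>X. inj_on (mat_app d m G) X \<longrightarrow> 16 ^ (9 + j) * s < edist m p x \<longrightarrow>
        edist m p x \<le> 16 ^ (10 + j) * s \<longrightarrow>
        edist d (mat_app d m G p) (mat_app d m G x) \<le> 3 * radius d (mat_app d m G ` X) (mat_app d m G p) \<longrightarrow>
        1 \<le> W G) \<and>
     (\<integral>G. W G \<partial>gaussian_matrix d m) \<le> 3 / 32 ^ j"
proof -
  let ?M = "gaussian_matrix d m"
  let ?D = "\<lambda>x y G. edist d (mat_app d m G x) (mat_app d m G y)"
  let ?l = "doubling_const m X"
  \<comment> \<open>9 is the least offset with 360 \<le> 2^9, which makes the final base
    \<open>2 ^ i * (360 / 4 ^ i)\<close> at most \<open>(1 / 2) ^ j\<close>.\<close>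
  define i where "i = 9 + j"
  define t where "t = 4 ^ i * s"
  have d1: "d \<ge> 1" using d by simp
  have s: "s > 0" using radius_pos[OF X(1) p] by (simp add: s_def)
  have "(4::real) ^ 9 \<le> 4 ^ i" by (rule power_increasing) (auto simp: i_def)
  then have four: "(4::real) ^ i \<ge> 262144" by simp
  have t: "t > 0" by (simp add: t_def s)
  have l_pow: "?l ^ a \<le> ?l ^ b" if "a \<le> b" for a b
    using dbl that by (intro power_increasing) auto
  have "2 * ?l \<le> ?l ^ 2" using dbl by (simp add: power2_eq_square)
  also have "\<dots> \<le> ?l ^ 8" by (rule l_pow) simp
  finally have "2 * ?l \<le> 2 ^ d" using dbl by linarith
  then have dbl': "2 * real ?l \<le> 2 ^ d"
    by (metis of_nat_le_iff of_nat_mult of_nat_numeral of_nat_power)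
  \<comment> \<open>\<open>\<beta>\<close> will bound the integral of every majorant; 360 = 30 * 12
    joins the constant of \<open>gaussian_ball_expansion\<close> to the threshold
    \<open>t / 12\<close>. Below the Markov threshold \<open>c\<close>, images of the
    \<open>s\<close>-ball stay within \<open>t / 12\<close>.\<close>
  define \<beta> where "\<beta> = (360 / 4 ^ i :: real) ^ d"
  define c where "c = (t / 12) ^ (2 * d)"
  have c: "c > 0" using t by (simp add: c_def)
  have exp_bound: "(30 * s) ^ (2 * d) / c \<le> \<beta>"
  proof -
    have "(30 * s) ^ (2 * d) / c = (360 / 4 ^ i) ^ (2 * d)"
      using s unfolding c_def t_def power_divide[symmetric] by (intro arg_cong[of _ _ "\<lambda>x. x ^ (2 * d)"]) (simp add: field_simps)
    also have "\<dots> \<le> \<beta>" unfolding \<beta>_def using four by (intro power_decreasing) auto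
    finally show ?thesis .
  qed
  have "\<exists>U. integrable ?M U \<and> (\<forall>G. 0 \<le> U G) \<and> (\<forall>G. \<forall>y\<in>rel_ball m X x s. ?D x y G ^ (2 * d) \<le> U G) \<and>
      (\<integral>G. U G \<partial>?M) \<le> (30 * s) ^ (2 * d)" if "x \<in> X" for x
    by (rule gaussian_ball_expansion[OF d1 X dbl' that s])
  then obtain U where U: "\<And>x. x \<in> X \<Longrightarrow> integrable ?M (U x)" "\<And>x G. x \<in> X \<Longrightarrow> 0 \<le> U x G"
    "\<And>x y G. x \<in> X \<Longrightarrow> y \<in> rel_ball m X x s \<Longrightarrow> ?D x y G ^ (2 * d) \<le> U x G"
    "\<And>x. x \<in> X \<Longrightarrow> (\<integral>G. U x G \<partial>?M) \<le> (30 * s) ^ (2 * d)"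
    by metis
  have expand: "?D x y G \<le> t / 12" if "U x G < c" "x \<in> X" "y \<in> rel_ball m X x s" for x y G
  proof (rule less_imp_le, rule power_less_imp_less_base)
    show "?D x y G ^ (2 * d) < (t / 12) ^ (2 * d)"
      using U(3)[OF that(2,3), of G] that(1) by (simp add: c_def)
  qed (use t in auto)
  \<comment> \<open>As \<open>2 ^ (4 * (i + 1)) = 16 ^ (i + 1)\<close>, this is an
    \<open>s\<close>-net of the ball bounding the annulus from outside.\<close>
  obtain S where S: "S \<subseteq> X" "finite S" "card S \<le> ?l ^ (4 * (i + 1))"
    "rel_ball m X p (2 ^ (4 * (i + 1)) * s) \<subseteq> (\<Union>y\<in>S. rel_ball m X y s)"
    using doubling_cover_iterate[OF X(1) p s, where n = m and k = "4 * (i + 1)"] by (elim exE conjE)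
  \<comment> \<open>A net point within \<open>s\<close> of the annulus is at distance at least
    \<open>16 ^ i * s - s\<close>, hence in \<open>T\<close>. For points of \<open>T\<close>,
    projected distance at most \<open>t\<close> is a contraction of order
    \<open>4 ^ i\<close>.\<close>
  define T where "T = {y \<in> S. 16 ^ i * s / 2 \<le> edist m p y}"
  have T: "T \<subseteq> X" "finite T" using S by (auto simp: T_def)
  have "card T \<le> card S" using S by (intro card_mono) (auto simp: T_def)
  also have "\<dots> \<le> ?l ^ (8 * i)" using S(3) l_pow[of "4 * (i + 1)" "8 * i"] by (simp add: i_def)
  also have "\<dots> \<le> (2 ^ d) ^ i" unfolding power_mult using dbl by (intro power_mono) auto
  finally have cardT: "real (card T) \<le> (2 ^ i) ^ d"
    by (metis of_nat_le_iff of_nat_numeral of_nat_power mult.commute power_mult)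
  have far: "edist m p y > 0" if "y \<in> T" for y
    using that s by (auto simp: T_def intro: less_le_trans[of _ "16 ^ i * s / 2"])
  have "\<exists>V. integrable ?M V \<and> (\<forall>G. 0 \<le> V G) \<and> (\<forall>G. ?D p y G \<le> t \<longrightarrow> 1 \<le> V G) \<and>
      (\<integral>G. V G \<partial>?M) \<le> (2 * t / edist m p y) ^ d" if "y \<in> T" for y
    by (rule gaussian_small_ball[OF d1 far[OF that] t])
  then obtain V where V: "\<And>y. y \<in> T \<Longrightarrow> integrable ?M (V y)" "\<And>y G. y \<in> T \<Longrightarrow> 0 \<le> V y G"
    "\<And>y G. y \<in> T \<Longrightarrow> ?D p y G \<le> t \<Longrightarrow> 1 \<le> V y G"
    "\<And>y. y \<in> T \<Longrightarrow> (\<integral>G. V y G \<partial>?M) \<le> (2 * t / edist m p y) ^ d"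
    by metis
  have V_bound: "(\<integral>G. V y G \<partial>?M) \<le> \<beta>" if y: "y \<in> T" for y
  proof (rule order_trans[OF V(4)[OF y]])
    have "(16::real) ^ i = 4 ^ i * 4 ^ i" by (simp add: power_mult_distrib[symmetric])
    then have "4 ^ i * t / 2 \<le> edist m p y" using y by (simp add: T_def t_def)
    then have "2 * t / edist m p y \<le> 2 * t / (4 ^ i * t / 2)"
      using t far[OF y] by (intro divide_left_mono mult_pos_pos) auto
    also have "\<dots> \<le> 360 / 4 ^ i" using t by (simp add: field_simps)
    finally show "(2 * t / edist m p y) ^ d \<le> \<beta>"
      unfolding \<beta>_def using t by (intro power_mono) auto
  qed
  define W where "W = (\<lambda>G. U p G / c + (\<Sum>y\<in>T. V y G + U y G / c))"
  have int: "integrable ?M (\<lambda>G. U x G / c)" if "x \<in> X" for x using U(1)[OF that] by simp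
  have int_le: "(\<integral>G. U x G / c \<partial>?M) \<le> \<beta>" if "x \<in> X" for x
  proof -
    have "(\<integral>G. U x G / c \<partial>?M) = (\<integral>G. U x G \<partial>?M) / c" by simp
    also have "\<dots> \<le> (30 * s) ^ (2 * d) / c" using U(4)[OF that] c by (intro divide_right_mono) auto
    finally show ?thesis using exp_bound by simp
  qed
  have nonneg: "0 \<le> U x G / c" if "x \<in> X" for x G using U(2)[OF that] c by simp
  have intT: "integrable ?M (\<lambda>G. V y G + U y G / c)" if "y \<in> T" for y
    using V(1)[OF that] int[of y] that T by auto
  have nonnegT: "0 \<le> V y G" "0 \<le> U y G / c" if "y \<in> T" for y G
    using V(2)[OF that] nonneg[of y] that T by auto
  have "integrable ?M W" unfolding W_def
    by (intro Bochner_Integration.integrable_add Bochner_Integration.integrable_sum int p intT)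
  moreover have "0 \<le> W G" for G unfolding W_def
    by (intro add_nonneg_nonneg sum_nonneg nonneg p nonnegT)
  moreover have "1 \<le> W G" if x: "x \<in> X" and inj: "inj_on (mat_app d m G) X"
    and x1: "16 ^ (9 + j) * s < edist m p x" and x2: "edist m p x \<le> 16 ^ (10 + j) * s"
    and near: "?D p x G \<le> 3 * radius d (mat_app d m G ` X) (mat_app d m G p)" for G x
  \<comment> \<open>If the expansion terms at \<open>p\<close> and at the net point \<open>y\<close>
    near \<open>x\<close> are both below 1, then \<open>?D p y G\<close> is at most 3 s + t/4 + t/12
    \<le> t, so the contraction term of \<open>y\<close> is at least 1.\<close>
  proof (cases "U p G < c")
    case False
    then have "1 \<le> U p G / c" using c by simp
    moreover have "0 \<le> (\<Sum>y\<in>T. V y G + U y G / c)" by (intro add_nonneg_nonneg sum_nonneg nonnegT)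
    ultimately show ?thesis by (simp add: W_def)
  next
    case True
    have "radius d (mat_app d m G ` X) (mat_app d m G p) \<le> s + t / 12"
      unfolding s_def by (rule radius_image_le[OF X(1) p inj])
        (use expand[OF True p] in \<open>auto simp: s_def\<close>)
    then have px: "?D p x G \<le> 3 * s + t / 4" using near by simp
    have "(2::real) ^ (4 * (i + 1)) = 16 ^ (10 + j)" unfolding power_mult by (simp add: i_def)
    then have "x \<in> rel_ball m X p (2 ^ (4 * (i + 1)) * s)"
      using x x2 by (simp add: rel_ball_def)
    then obtain y where y: "y \<in> S" "x \<in> rel_ball m X y s" using S(4) by blast
    have "(16::real) ^ 1 \<le> 16 ^ i" by (rule power_increasing) (auto simp: i_def)
    then have "2 * s \<le> 16 ^ i * s" using s by (intro mult_right_mono) auto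
    moreover have "edist m p x \<le> edist m p y + edist m y x" by (rule edist_triangle)
    moreover have "edist m y x \<le> s" using y by (simp add: rel_ball_def)
    ultimately have yT: "y \<in> T" using y x1 by (simp add: T_def i_def)
    have yX: "y \<in> X" using yT T by auto
    have "1 \<le> V y G + U y G / c"
    proof (cases "U y G < c")
      case False
      then have "1 \<le> U y G / c" using c by simp
      then show ?thesis using nonnegT[OF yT, of G] by simp
    next
      case True
      have "?D p y G \<le> ?D p x G + ?D x y G" by (rule edist_triangle)
      also have "?D x y G \<le> t / 12" using expand[OF True yX y(2)] by (simp add: edist_commute)
      also have "262144 * s \<le> t" unfolding t_def using four s by (intro mult_right_mono) auto
      then have "?D p x G + t / 12 \<le> t" using px s by simp
      finally have "1 \<le> V y G" using V(3)[OF yT] by simp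
      then show ?thesis using nonnegT[OF yT, of G] by simp
    qed
    also have "\<dots> \<le> (\<Sum>y\<in>T. V y G + U y G / c)"
      by (rule member_le_sum[OF yT]) (use nonnegT T in \<open>auto intro: add_nonneg_nonneg\<close>)
    finally show ?thesis using nonneg[OF p, of G] by (simp add: W_def)
  qed
  moreover have "(\<integral>G. W G \<partial>?M) \<le> 3 / 32 ^ j"
  proof -
    have "(\<integral>G. W G \<partial>?M) = (\<integral>G. U p G / c \<partial>?M) + (\<integral>G. (\<Sum>y\<in>T. V y G + U y G / c) \<partial>?M)"
      unfolding W_def by (intro Bochner_Integration.integral_add int p Bochner_Integration.integrable_sum intT)
    also have "(\<integral>G. (\<Sum>y\<in>T. V y G + U y G / c) \<partial>?M) = (\<Sum>y\<in>T. (\<integral>G. V y G \<partial>?M) + (\<integral>G. U y G / c \<partial>?M))"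
      using V(1) int T
      by (subst Bochner_Integration.integral_sum[OF intT]) (auto intro!: sum.cong Bochner_Integration.integral_add simp del: integral_divide_zero)
    also have "\<dots> \<le> (\<Sum>y\<in>T. \<beta> + \<beta>)" using T by (intro sum_mono add_mono V_bound int_le) auto
    also have "(\<integral>G. U p G / c \<partial>?M) \<le> \<beta>" by (rule int_le[OF p])
    also have "\<beta> + (\<Sum>y\<in>T. \<beta> + \<beta>) = \<beta> + 2 * (real (card T) * \<beta>)" by simp
    also have "\<dots> \<le> (2 ^ i) ^ d * \<beta> + 2 * ((2 ^ i) ^ d * \<beta>)"
    proof -
      have "0 \<le> \<beta>" by (simp add: \<beta>_def)
      moreover have "1 * \<beta> \<le> (2 ^ i) ^ d * \<beta>" by (intro mult_right_mono) (auto simp: \<beta>_def)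
      ultimately show ?thesis using cardT by (intro add_mono mult_left_mono mult_right_mono) auto
    qed
    also have "\<dots> = 3 * (2 ^ i * (360 / 4 ^ i)) ^ d" unfolding \<beta>_def power_mult_distrib by simp
    also have "\<dots> \<le> 3 * ((1 / 2) ^ j) ^ d"
    proof (intro mult_left_mono power_mono)
      have "(4::real) ^ i = 2 ^ i * 2 ^ i" by (simp add: power_mult_distrib[symmetric])
      then show "(2::real) ^ i * (360 / 4 ^ i) \<le> (1 / 2) ^ j"
        by (simp add: i_def power_add field_simps)
    qed auto
    also have "\<dots> = 3 * (1 / 2) ^ (j * d)" by (simp add: power_mult)
    \<comment> \<open>\<open>d \<ge> 5\<close> gives the base 2^5 = 32, above the factor 16 between
      consecutive scales.\<close>
    also have "\<dots> \<le> 3 * (1 / 2) ^ (j * 5)"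
      using d by (intro mult_left_mono power_decreasing) auto
    also have "(1 / 2 :: real) ^ (j * 5) = 1 / 32 ^ j"
      by (subst mult.commute, subst power_mult) (simp add: power_divide)
    finally show ?thesis by simp
  qed
  ultimately show ?thesis by (intro exI[of _ W]) blast
qed

text \<open>Sums the annulus bounds over the scales. The assumption on \<open>d\<close> is
  conditional because a singleton has doubling dimension 0, which does not force \<open>d\<close> to
  be large; its only distance is 0.\<close>

lemma gaussian_facility_distance:
  assumes d: "d \<ge> 1" and X: "finite X" "X \<subseteq> Rn m" and p: "p \<in> X"
    and dbl: "X \<noteq> {p} \<Longrightarrow> d \<ge> 5 \<and> 2 \<le> doubling_const m X \<and> doubling_const m X ^ 8 \<le> 2 ^ d"
  shows "\<exists>V. integrable (gaussian_matrix d m) V \<and>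
     (\<forall>G. \<forall>x\<in>X. inj_on (mat_app d m G) X \<longrightarrow>
        edist d (mat_app d m G p) (mat_app d m G x) \<le> 3 * radius d (mat_app d m G ` X) (mat_app d m G p) \<longrightarrow>
        edist m p x \<le> V G) \<and>
     (\<integral>G. V G \<partial>gaussian_matrix d m) \<le> 7 * 16 ^ 10 * radius m X p"
proof (cases "X = {p}")
  case True
  then show ?thesis
    using radius_pos[OF X(1) p, of m] by (intro exI[of _ "\<lambda>_. 0"]) simp
next
  case False
  let ?M = "gaussian_matrix d m"
  interpret prob_space ?M by (rule prob_space_gaussian_matrix[OF d])
  define s where "s = radius m X p"
  have s: "s > 0" using radius_pos[OF X(1) p] by (simp add: s_def)
  let ?near = "\<lambda>G x. edist d (mat_app d m G p) (mat_app d m G x)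
      \<le> 3 * radius d (mat_app d m G ` X) (mat_app d m G p)"
  have "\<exists>W :: (nat \<times> nat \<Rightarrow> real) \<Rightarrow> real. integrable ?M W \<and> (\<forall>G. 0 \<le> W G) \<and>
     (\<forall>G. \<forall>x\<in>X. inj_on (mat_app d m G) X \<longrightarrow> 16 ^ (9 + j) * s < edist m p x \<longrightarrow>
        edist m p x \<le> 16 ^ (10 + j) * s \<longrightarrow> ?near G x \<longrightarrow> 1 \<le> W G) \<and>
     (\<integral>G. W G \<partial>?M) \<le> 3 / 32 ^ j" for j
    unfolding s_def using dbl[OF False] by (intro gaussian_annulus X p) auto
  then obtain W :: "nat \<Rightarrow> (nat \<times> nat \<Rightarrow> real) \<Rightarrow> real" where W: "\<And>j. integrable ?M (W j)" "\<And>j G. 0 \<le> W j G"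
    "\<And>j G x. x \<in> X \<Longrightarrow> inj_on (mat_app d m G) X \<Longrightarrow> 16 ^ (9 + j) * s < edist m p x \<Longrightarrow>
        edist m p x \<le> 16 ^ (10 + j) * s \<Longrightarrow> ?near G x \<Longrightarrow> 1 \<le> W j G"
    "\<And>j. (\<integral>G. W j G \<partial>?M) \<le> 3 / 32 ^ j"
    by metis
  define R where "R = Max (edist m p ` X)"
  have R: "edist m p x \<le> R" if "x \<in> X" for x using that X by (simp add: R_def)
  \<comment> \<open>All of \<open>X\<close> lies within scale \<open>N\<close>, so finitely many
    annuli suffice.\<close>
  obtain N :: nat where "R / (16 ^ 9 * s) < 16 ^ N" using real_arch_pow[of 16] by auto
  then have N: "R < 16 ^ (9 + N) * s"
    using s by (simp add: pos_divide_less_eq power_add mult_ac)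
  define V where "V = (\<lambda>G. 16 ^ 9 * s + (\<Sum>j<N. 16 ^ (10 + j) * s * W j G))"
  have "integrable ?M V" unfolding V_def
    by (intro Bochner_Integration.integrable_add Bochner_Integration.integrable_sum
        integrable_mult_right W) simp
  moreover have "edist m p x \<le> V G"
    if x: "x \<in> X" and inj: "inj_on (mat_app d m G) X" and near: "?near G x" for G x
  proof (cases "edist m p x \<le> 16 ^ 9 * s")
    case True
    have "0 \<le> (\<Sum>j<N. 16 ^ (10 + j) * s * W j G)"
      using W(2) s by (intro sum_nonneg mult_nonneg_nonneg) auto
    then show ?thesis using True by (simp add: V_def)
  next
    case False
    let ?P = "\<lambda>j. edist m p x \<le> 16 ^ (9 + j) * s"
    \<comment> \<open>The least ball containing \<open>x\<close> has positive index
      \<open>k\<close>, so \<open>x\<close> lies in the annulus with index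
      \<open>k - 1\<close>.\<close>
    define k where "k = (LEAST j. ?P j)"
    have PN: "?P N" using R[OF x] N by simp
    then have Pk: "?P k" unfolding k_def by (rule LeastI)
    have kN: "k \<le> N" unfolding k_def using PN by (rule Least_le)
    have "k \<noteq> 0" using Pk False by (cases "k = 0") auto
    then obtain j where j: "k = Suc j" using not0_implies_Suc by blast
    have "\<not> ?P j" using not_less_Least[of j ?P] j by (simp add: k_def)
    then have "1 \<le> W j G" using Pk by (intro W(3)[OF x inj _ _ near]) (auto simp: j)
    then have "16 ^ (10 + j) * s * 1 \<le> 16 ^ (10 + j) * s * W j G"
      using s by (intro mult_left_mono) auto
    moreover have "edist m p x \<le> 16 ^ (10 + j) * s" using Pk by (simp add: j)
    moreover have "16 ^ (10 + j) * s * W j G \<le> (\<Sum>j<N. 16 ^ (10 + j) * s * W j G)"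
      by (rule member_le_sum) (use s W(2) kN j in auto)
    moreover have "0 \<le> 16 ^ 9 * s" using s by simp
    ultimately show ?thesis unfolding V_def by linarith
  qed
  moreover have "(\<integral>G. V G \<partial>?M) \<le> 7 * 16 ^ 10 * s"
  proof -
    have "(\<integral>G. V G \<partial>?M) = 16 ^ 9 * s + (\<integral>G. (\<Sum>j<N. 16 ^ (10 + j) * s * W j G) \<partial>?M)"
      unfolding V_def by (subst Bochner_Integration.integral_add)
        (auto intro!: Bochner_Integration.integrable_sum integrable_mult_right W simp: prob_space)
    also have "(\<integral>G. (\<Sum>j<N. 16 ^ (10 + j) * s * W j G) \<partial>?M) = (\<Sum>j<N. 16 ^ (10 + j) * s * (\<integral>G. W j G \<partial>?M))"
      using W(1) by (subst Bochner_Integration.integral_sum) auto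
    also have "\<dots> \<le> (\<Sum>j<N. 16 ^ (10 + j) * s * (3 / 32 ^ j))"
      using s by (intro sum_mono mult_left_mono W) auto
    \<comment> \<open>The ratio 16/32 leaves a geometric series bounded by 2, and 16^9 + 6 * 16^10
      \<le> 7 * 16^10.\<close>
    also have "\<dots> = 3 * 16 ^ 10 * s * (\<Sum>j<N. (1 / 2) ^ j)"
    proof -
      have "(32::real) ^ j = 16 ^ j * 2 ^ j" for j by (simp add: power_mult_distrib[symmetric])
      then show ?thesis unfolding sum_distrib_left
        by (intro sum.cong) (auto simp: power_add power_divide)
    qed
    also have "(\<Sum>j<N. (1 / 2 :: real) ^ j) \<le> 2"
      by (subst geometric_sum) (auto simp: field_simps)
    finally show ?thesis using s by simp
  qed
  ultimately show ?thesis unfolding s_def by (intro exI[of _ V]) blast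
qed

section \<open>The projected cost and the main inequality\<close>

text \<open>
  Almost surely every multiplicity on the right is one; the formula makes sums over the random set
  \<open>GX\<close> measurable on all of the (incomplete) matrix space.
\<close>
lemma sum_image_eq_sum_div_card:
  fixes h :: "'b \<Rightarrow> real"
  assumes X: "finite X"
  shows "(\<Sum>y\<in>g ` X. h y) = (\<Sum>x\<in>X. h (g x) / card {x' \<in> X. g x' = g x})"
proof -
  have "(\<Sum>x\<in>X. h (g x) / card {x' \<in> X. g x' = g x})
      = (\<Sum>y\<in>g ` X. \<Sum>x | x \<in> X \<and> g x = y. h (g x) / card {x' \<in> X. g x' = g x})"
    by (rule sum.image_gen[OF X])
  also have "\<dots> = (\<Sum>y\<in>g ` X. h y)"
  proof (rule sum.cong[OF refl])
    fix y assume "y \<in> g ` X"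
    then have "{x \<in> X. g x = y} \<noteq> {}" by auto
    then have "card {x \<in> X. g x = y} \<noteq> 0" using X by auto
    moreover have "(\<Sum>x | x \<in> X \<and> g x = y. h (g x) / card {x' \<in> X. g x' = g x})
        = (\<Sum>x | x \<in> X \<and> g x = y. h y / card {x' \<in> X. g x' = y})"
      by (rule sum.cong) auto
    ultimately show "(\<Sum>x | x \<in> X \<and> g x = y. h (g x) / card {x' \<in> X. g x' = g x}) = h y"
      by simp
  qed
  finally show ?thesis ..
qed

lemma borel_measurable_sum_mat_app_image:
  assumes X: "finite X"
    and h: "\<And>x. x \<in> X \<Longrightarrow> (\<lambda>G. h G (mat_app d m G x)) \<in> borel_measurable (gaussian_matrix d m)"
  shows "(\<lambda>G. \<Sum>y\<in>mat_app d m G ` X. h G y :: real) \<in> borel_measurable (gaussian_matrix d m)"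
proof -
  \<comment> \<open>Images lie in \<open>Rn d\<close>, so their coincidence is the event of distance
    0, which makes the multiplicities measurable.\<close>
  have "real (card {x' \<in> X. mat_app d m G x' = mat_app d m G x})
      = (\<Sum>x'\<in>X. if edist d (mat_app d m G x') (mat_app d m G x) = 0 then 1 else 0)" for G x
    using X by (simp add: edist_eq_0_iff sum.If_cases Int_def)
  then have "(\<lambda>G. \<Sum>y\<in>mat_app d m G ` X. h G y) = (\<lambda>G. \<Sum>x\<in>X. h G (mat_app d m G x) /
      (\<Sum>x'\<in>X. if edist d (mat_app d m G x') (mat_app d m G x) = 0 then 1 else 0))"
    by (simp add: sum_image_eq_sum_div_card[OF X] fun_eq_iff)
  also have "\<dots> \<in> borel_measurable (gaussian_matrix d m)"
    by (intro borel_measurable_sum borel_measurable_divide h) measurable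
  finally show ?thesis .
qed

text \<open>\<open>F\<close> has values in the finite set \<open>Pow X\<close>, so it is enough to
  treat a fixed value \<open>S\<close>.\<close>

lemma borel_measurable_projected_cost:
  assumes X: "finite X" and F: "F \<in> gaussian_matrix d m \<rightarrow>\<^sub>M count_space (Pow X)"
  shows "(\<lambda>G. fl_cost d (mat_app d m G ` X) (mat_app d m G ` F G)) \<in> borel_measurable (gaussian_matrix d m)"
proof (rule measurable_compose_countable'[where f = "\<lambda>S G. fl_cost d (mat_app d m G ` X) (mat_app d m G ` S)", OF _ F])
  show "countable (Pow X)" using X by (simp add: countable_finite)
  fix S assume "S \<in> Pow X"
  then have S: "finite S" using X finite_subset by auto
  have "(\<lambda>G. \<Sum>y\<in>mat_app d m G ` S. 1 :: real) \<in> borel_measurable (gaussian_matrix d m)"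
    by (rule borel_measurable_sum_mat_app_image[OF S]) simp
  moreover have "(\<lambda>G. \<Sum>y\<in>mat_app d m G ` X. Min ((\<lambda>f. edist d y f) ` mat_app d m G ` S))
      \<in> borel_measurable (gaussian_matrix d m)"
  proof (rule borel_measurable_sum_mat_app_image[OF X])
    fix x assume "x \<in> X"
    show "(\<lambda>G. Min ((\<lambda>f. edist d (mat_app d m G x) f) ` mat_app d m G ` S)) \<in> borel_measurable (gaussian_matrix d m)"
      unfolding image_image by (intro borel_measurable_Min S) measurable
  qed
  ultimately show "(\<lambda>G. fl_cost d (mat_app d m G ` X) (mat_app d m G ` S)) \<in> borel_measurable (gaussian_matrix d m)"
    unfolding fl_cost_def by simp
qed

lemma integrable_edist_mat_app:
  assumes d: "d \<ge> 1"
  shows "integrable (gaussian_matrix d m) (\<lambda>G. edist d (mat_app d m G x) (mat_app d m G y))"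
proof (rule Bochner_Integration.integrable_bound)
  interpret prob_space "gaussian_matrix d m" by (rule prob_space_gaussian_matrix[OF d])
  show "integrable (gaussian_matrix d m) (\<lambda>G. 1 + edist d (mat_app d m G x) (mat_app d m G y) ^ (2 * d))"
    using gaussian_moment(1)[OF d] by simp
  have "a \<le> 1 + a ^ (2 * d)" if "a \<ge> 0" for a :: real
  proof (cases "a \<le> 1")
    case False
    then show ?thesis using self_le_power[of a "2 * d"] d by auto
  qed (use that in \<open>auto intro: add_increasing2\<close>)
  then show "AE G in gaussian_matrix d m. norm (edist d (mat_app d m G x) (mat_app d m G y))
      \<le> norm (1 + edist d (mat_app d m G x) (mat_app d m G y) ^ (2 * d))"
    by simp
qed measurable

lemma (in prob_space) integrable_finite_range:
  fixes g :: "'b \<Rightarrow> real"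
  assumes "finite A" "F \<in> M \<rightarrow>\<^sub>M count_space A"
  shows "integrable M (\<lambda>x. g (F x))"
proof (rule integrable_const_bound)
  have "norm (g (F x)) \<le> Max ((\<lambda>a. norm (g a)) ` A)" if "x \<in> space M" for x
    using measurable_space[OF assms(2) that] assms(1) by simp
  then show "AE x in M. norm (g (F x)) \<le> Max ((\<lambda>a. norm (g a)) ` A)"
    by (rule AE_I2)
  show "(\<lambda>x. g (F x)) \<in> borel_measurable M"
    by (rule measurable_compose[OF assms(2)]) simp
qed

lemma Min_edist_nonneg:
  assumes "finite S" "S \<noteq> {}"
  shows "0 \<le> Min ((\<lambda>f. edist n y f) ` S)"
  using assms by simp

text \<open>A nonintegrable function has Bochner integral 0, so without this a pointwise lower bound
  on the projected cost would not pass to expectations. All pairwise projected distances plus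
  \<open>card X\<close> form the majorant.\<close>

lemma integrable_projected_cost:
  assumes d: "d \<ge> 1" and X: "finite X" "X \<subseteq> Rn m"
    and F: "F \<in> gaussian_matrix d m \<rightarrow>\<^sub>M count_space (Pow X)"
    and ne: "AE G in gaussian_matrix d m. F G \<noteq> {}"
  shows "integrable (gaussian_matrix d m) (\<lambda>G. fl_cost d (mat_app d m G ` X) (mat_app d m G ` F G))"
proof (rule Bochner_Integration.integrable_bound)
  let ?D = "\<lambda>G x y. edist d (mat_app d m G x) (mat_app d m G y)"
  interpret prob_space "gaussian_matrix d m" by (rule prob_space_gaussian_matrix[OF d])
  show "integrable (gaussian_matrix d m) (\<lambda>G. real (card X) + (\<Sum>x\<in>X. \<Sum>y\<in>X. ?D G x y))"
    by (intro Bochner_Integration.integrable_add Bochner_Integration.integrable_sum integrable_edist_mat_app d) simp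
  show "AE G in gaussian_matrix d m. norm (fl_cost d (mat_app d m G ` X) (mat_app d m G ` F G))
      \<le> norm (real (card X) + (\<Sum>x\<in>X. \<Sum>y\<in>X. ?D G x y))"
    using ne AE_mat_app_inj_on[OF d X] AE_space
  proof eventually_elim
    case (elim G)
    then have FX: "F G \<subseteq> X" using measurable_space[OF F] by auto
    then have fin: "finite (F G)" using X finite_subset by auto
    then obtain f where f: "f \<in> F G" using elim by auto
    have "card (mat_app d m G ` F G) \<le> card X"
      using card_image_le[OF fin] card_mono[OF X(1) FX] by (rule order_trans)
    moreover have "(\<Sum>y\<in>mat_app d m G ` X. Min ((\<lambda>f. edist d y f) ` mat_app d m G ` F G))
        \<le> (\<Sum>x\<in>X. \<Sum>y\<in>X. ?D G x y)"
      unfolding sum.reindex[OF elim(2)] comp_def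
    proof (rule sum_mono)
      fix x
      have "Min ((\<lambda>f. edist d (mat_app d m G x) f) ` mat_app d m G ` F G) \<le> ?D G x f"
        using f fin by (intro Min_le) auto
      also have "\<dots> \<le> (\<Sum>y\<in>X. ?D G x y)" by (rule member_le_sum) (use f FX X in auto)
      finally show "Min ((\<lambda>f. edist d (mat_app d m G x) f) ` mat_app d m G ` F G) \<le> (\<Sum>y\<in>X. ?D G x y)" .
    qed
    moreover have "0 \<le> fl_cost d (mat_app d m G ` X) (mat_app d m G ` F G)"
      unfolding fl_cost_def using fin f by (intro add_nonneg_nonneg sum_nonneg Min_edist_nonneg) auto
    moreover have "0 \<le> (\<Sum>x\<in>X. \<Sum>y\<in>X. ?D G x y)" by (intro sum_nonneg) simp
    ultimately show ?case by (simp add: fl_cost_def)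
  qed
qed (rule borel_measurable_projected_cost[OF X(1) F])

text \<open>A doubling constant of at least 2 means dimension at least 1, and ln (1/\<epsilon>)
  \<ge> 1 - \<epsilon> > 1/2 > \<epsilon>^2 makes the factor involving \<epsilon> at least 1. Hence
  \<open>d \<ge> 8 * doubling_dim m X\<close>.\<close>

lemma dimension_bound_imp_doubling_bound:
  assumes \<epsilon>: "0 < \<epsilon>" "\<epsilon> < 1 / 2" and l: "2 \<le> doubling_const m X"
    and d: "real d \<ge> 8 * doubling_dim m X * ln (1 / \<epsilon>) / \<epsilon>\<^sup>2"
  shows "d \<ge> 8" "doubling_const m X ^ 8 \<le> 2 ^ d"
proof -
  let ?l = "doubling_const m X"
  have dim: "doubling_dim m X \<ge> 1"
    using l by (simp add: doubling_dim_def le_log_iff)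
  have "1 - \<epsilon> \<le> ln (1 / \<epsilon>)" using ln_le_minus_one[of \<epsilon>] \<epsilon> by (simp add: ln_div)
  moreover have "\<epsilon>\<^sup>2 \<le> 1 / 4" using power_mono[of \<epsilon> "1 / 2" 2] \<epsilon> by (simp add: power_divide)
  ultimately have "\<epsilon>\<^sup>2 \<le> ln (1 / \<epsilon>)" using \<epsilon> by linarith
  then have "1 \<le> ln (1 / \<epsilon>) / \<epsilon>\<^sup>2" using \<epsilon> by simp
  then have "8 * doubling_dim m X * 1 \<le> 8 * doubling_dim m X * (ln (1 / \<epsilon>) / \<epsilon>\<^sup>2)"
    using dim by (intro mult_left_mono) auto
  then have le: "8 * doubling_dim m X \<le> d" using d by simp
  then show "d \<ge> 8" using dim by linarith
  have "real ?l ^ 8 = (2 powr doubling_dim m X) ^ 8" using l by (simp add: doubling_dim_def)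
  also have "\<dots> = 2 powr (8 * doubling_dim m X)" by (simp add: powr_powr powr_realpow[symmetric] mult.commute)
  also have "\<dots> \<le> 2 powr d" using le by (intro powr_mono) auto
  also have "\<dots> = 2 ^ d" by (simp add: powr_realpow)
  finally show "?l ^ 8 \<le> 2 ^ d" by (metis of_nat_le_iff of_nat_numeral of_nat_power)
qed

theorem theorem4p2:
  "\<exists>C0>0::real. \<exists>C1>0::real.
     \<forall>(m::nat) (d::nat) (X::(nat \<Rightarrow> real) set) (\<epsilon>::real)
       (F::(nat \<times> nat \<Rightarrow> real) \<Rightarrow> (nat \<Rightarrow> real) set).
       finite X \<and> X \<noteq> {} \<and> X \<subseteq> Rn m \<and> 0 < \<epsilon> \<and> \<epsilon> < 1 / 2 \<and> d \<ge> 1 \<and>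
       real d \<ge> C0 * doubling_dim m X * ln (1 / \<epsilon>) / \<epsilon>\<^sup>2 \<and>
       F \<in> gaussian_matrix d m \<rightarrow>\<^sub>M count_space (Pow X) \<and>
       (AE G in gaussian_matrix d m.
          locally_optimal d (mat_app d m G ` X) (mat_app d m G ` F G))
       \<longrightarrow>
       (\<integral>G. fl_cost m X (F G) \<partial>gaussian_matrix d m)
         \<le> (\<integral>G. real (card (F G)) \<partial>gaussian_matrix d m) + C1 * (\<Sum>p\<in>X. radius m X p)
       \<and>
       (\<integral>G. real (card (F G)) \<partial>gaussian_matrix d m) + C1 * (\<Sum>p\<in>X. radius m X p)
         \<le> (\<integral>G. fl_cost d (mat_app d m G ` X) (mat_app d m G ` F G) \<partial>gaussian_matrix d m)
             + 6 * C1 * fl_opt m X"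
\<comment> \<open>8 is the exponent in \<open>doubling_const m X ^ 8 \<le> 2 ^ d\<close>; the second
  witness is the constant of \<open>gaussian_facility_distance\<close>.\<close>
proof (rule exI[of _ 8], intro conjI, simp, rule exI[of _ "7 * 16 ^ 10"], intro conjI, simp, intro allI impI, (elim conjE)?)
  fix m d :: nat and X :: "(nat \<Rightarrow> real) set" and \<epsilon> :: real
    and F :: "(nat \<times> nat \<Rightarrow> real) \<Rightarrow> (nat \<Rightarrow> real) set"
  assume X: "finite X" "X \<noteq> {}" "X \<subseteq> Rn m" and \<epsilon>: "0 < \<epsilon>" "\<epsilon> < 1 / 2" and d: "d \<ge> 1"
    and dim: "real d \<ge> 8 * doubling_dim m X * ln (1 / \<epsilon>) / \<epsilon>\<^sup>2"
    and F: "F \<in> gaussian_matrix d m \<rightarrow>\<^sub>M count_space (Pow X)"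
    and opt: "AE G in gaussian_matrix d m. locally_optimal d (mat_app d m G ` X) (mat_app d m G ` F G)"
  let ?M = "gaussian_matrix d m"
  let ?C = "7 * 16 ^ 10 :: real"
  interpret prob_space ?M by (rule prob_space_gaussian_matrix[OF d])
  have good: "AE G in ?M. inj_on (mat_app d m G) X \<and> F G \<subseteq> X \<and> F G \<noteq> {} \<and> finite (F G) \<and>
      locally_optimal d (mat_app d m G ` X) (mat_app d m G ` F G)"
    using opt AE_mat_app_inj_on[OF d X(1,3)] AE_space
  proof eventually_elim
    case (elim G)
    then have "F G \<subseteq> X" using measurable_space[OF F] by auto
    then show ?case using elim X(1) finite_subset
      by (auto simp: locally_optimal_def fl_solution_def)
  qed
  \<comment> \<open>\<open>F\<close> takes finitely many values, so every real function of it is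
    bounded and measurable.\<close>
  have int: "integrable ?M (\<lambda>G. g (F G))" for g :: "(nat \<Rightarrow> real) set \<Rightarrow> real"
    by (rule integrable_finite_range[OF _ F]) (use X in simp)
  have dist: "(\<integral>G. Min ((\<lambda>f. edist m p f) ` F G) \<partial>?M) \<le> ?C * radius m X p" if p: "p \<in> X" for p
  proof -
    have "d \<ge> 5 \<and> 2 \<le> doubling_const m X \<and> doubling_const m X ^ 8 \<le> 2 ^ d" if "X \<noteq> {p}"
    proof -
      obtain q where "q \<in> X" "q \<noteq> p" using p \<open>X \<noteq> {p}\<close> by auto
      then have "2 \<le> doubling_const m X" using X p by (intro doubling_const_ge_2) auto
      then show ?thesis using dimension_bound_imp_doubling_bound[OF \<epsilon> _ dim] by auto
    qed
    then obtain V where V: "integrable ?M V"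
      "\<And>G x. x \<in> X \<Longrightarrow> inj_on (mat_app d m G) X \<Longrightarrow>
         edist d (mat_app d m G p) (mat_app d m G x) \<le> 3 * radius d (mat_app d m G ` X) (mat_app d m G p) \<Longrightarrow>
         edist m p x \<le> V G"
      "(\<integral>G. V G \<partial>?M) \<le> ?C * radius m X p"
      using gaussian_facility_distance[OF d X(1,3) p] by blast
    have "(\<integral>G. Min ((\<lambda>f. edist m p f) ` F G) \<partial>?M) \<le> (\<integral>G. V G \<partial>?M)"
    proof (rule integral_mono_AE[OF int V(1)])
      show "AE G in ?M. Min ((\<lambda>f. edist m p f) ` F G) \<le> V G"
        using good
      proof eventually_elim
        case (elim G)
        then obtain f where f: "f \<in> F G"
          "edist d (mat_app d m G p) (mat_app d m G f) \<le> 3 * radius d (mat_app d m G ` X) (mat_app d m G p)"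
          using p unfolding locally_optimal_def by blast
        have "Min ((\<lambda>f. edist m p f) ` F G) \<le> edist m p f" using f elim by (intro Min_le) auto
        also have "\<dots> \<le> V G" using f elim by (intro V) auto
        finally show ?case .
      qed
    qed
    then show ?thesis using V(3) by simp
  qed
  have "(\<integral>G. fl_cost m X (F G) \<partial>?M)
      = (\<integral>G. real (card (F G)) \<partial>?M) + (\<Sum>p\<in>X. \<integral>G. Min ((\<lambda>f. edist m p f) ` F G) \<partial>?M)"
    unfolding fl_cost_def
    by (subst Bochner_Integration.integral_add[OF int[of "\<lambda>S. real (card S)"]])
      (intro Bochner_Integration.integrable_sum int | subst Bochner_Integration.integral_sum, rule int, rule refl)+
  also have "\<dots> \<le> (\<integral>G. real (card (F G)) \<partial>?M) + ?C * (\<Sum>p\<in>X. radius m X p)"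
    unfolding sum_distrib_left by (intro add_left_mono sum_mono dist)
  finally have 1: "(\<integral>G. fl_cost m X (F G) \<partial>?M) \<le> (\<integral>G. real (card (F G)) \<partial>?M) + ?C * (\<Sum>p\<in>X. radius m X p)" .
  \<comment> \<open>Injectivity preserves the number of facilities and connection costs are
    nonnegative, so only the radius sum is left for the optimum to absorb.\<close>
  have "(\<integral>G. real (card (F G)) \<partial>?M) \<le> (\<integral>G. fl_cost d (mat_app d m G ` X) (mat_app d m G ` F G) \<partial>?M)"
  proof (rule integral_mono_AE)
    show "integrable ?M (\<lambda>G. fl_cost d (mat_app d m G ` X) (mat_app d m G ` F G))"
      by (rule integrable_projected_cost[OF d X(1,3) F]) (use good in \<open>auto elim: eventually_mono\<close>)
    show "AE G in ?M. real (card (F G)) \<le> fl_cost d (mat_app d m G ` X) (mat_app d m G ` F G)"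
      using good
    proof eventually_elim
      case (elim G)
      then have "card (mat_app d m G ` F G) = card (F G)"
        by (intro card_image) (auto intro: inj_on_subset)
      moreover have "0 \<le> (\<Sum>y\<in>mat_app d m G ` X. Min ((\<lambda>f. edist d y f) ` mat_app d m G ` F G))"
        using elim by (intro sum_nonneg Min_edist_nonneg) auto
      ultimately show ?case by (simp add: fl_cost_def)
    qed
  qed (rule int)
  moreover have "(\<Sum>p\<in>X. radius m X p) \<le> 6 * fl_opt m X"
  proof -
    have "0 \<le> (\<Sum>p\<in>X. radius m X p)"
      using radius_pos[OF X(1)] by (intro sum_nonneg) (simp add: less_imp_le)
    then show ?thesis using sum_radius_le_opt[OF X(1,2), of m] by linarith
  qed
  ultimately have 2: "(\<integral>G. real (card (F G)) \<partial>?M) + ?C * (\<Sum>p\<in>X. radius m X p)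
      \<le> (\<integral>G. fl_cost d (mat_app d m G ` X) (mat_app d m G ` F G) \<partial>?M) + 6 * ?C * fl_opt m X"
    by simp
  show "(\<integral>G. fl_cost m X (F G) \<partial>?M) \<le> (\<integral>G. real (card (F G)) \<partial>?M) + ?C * (\<Sum>p\<in>X. radius m X p) \<and>
      (\<integral>G. real (card (F G)) \<partial>?M) + ?C * (\<Sum>p\<in>X. radius m X p)
      \<le> (\<integral>G. fl_cost d (mat_app d m G ` X) (mat_app d m G ` F G) \<partial>?M) + 6 * ?C * fl_opt m X"
    using 1 2 by blast
qed

end
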